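(* Assume $\lambda^{a,s}(\delta)=\lambda^{b,s}(\delta)=\lambda^{a,o}(\delta)=\lambda^{b,o}(\delta)=A e^{-k\delta}$ with constants $A,k>0$. Let $$H_1(s_t,\nu_t,t)=-\gamma E_t\left[\int_t^T\nu_u\left(\Delta_u+\rho\xi C_\nu(S_u,\nu_u,u)\right)du\right],$$ $$H_2(s_t,\nu_t,t)=-\frac{\gamma}{2}E_t\left[\int_t^T\nu_u\left(\Delta_u^2+2\rho\xi\Delta_uC_\nu(S_u,\nu_u,u)+\xi^2C_\nu^2(S_u,\nu_u,u)\right)du\right].$$ Then the approximate optimal policy produced by the approximate treatment described in the context is $$\hat\delta_{t,*}^{a,s}=\frac1k-\left(\frac{\gamma}{2\theta}(\nu_t-\alpha)\left[1-e^{-\theta(T-t)}\right]+\frac{\gamma}{2}\alpha(T-t)\right)(2q_t^s-1)+H_1(s_t,\nu_t,t)q_t^o,$$ $$\hat\delta_{t,*}^{b,s}=\frac1k+\left(\frac{\gamma}{2\theta}(\nu_t-\alpha)\left[1-e^{-\theta(T-t)}\right]+\frac{\gamma}{2}\alpha(T-t)\right)(2q_t^s+1)-H_1(s_t,\nu_t,t)q_t^o,$$ $$\hat\delta_{t,*}^{a,o}=\frac1k+H_2(s_t,\nu_t,t)(2q_t^o-1)+H_1(s_t,\nu_t,t)q_t^s,$$ $$\hat\delta_{t,*}^{b,o}=\frac1k-H_2(s_t,\nu_t,t)(2q_t^o+1)-H_1(s_t,\nu_t,t)q_t^s.$$ Moreover the approximate value function is $$\tilde V(s_t,\nu_t,q_t^s,q_t^o,t)=-\left(\frac{\gamma}{2\theta}(\nu_t-\alpha)\left[1-e^{-\theta(T-t)}\right]+\frac{\gamma}{2}\alpha(T-t)\right)(q_t^s)^2+H_1(s_t,\nu_t,t)q_t^sq_t^o+H_2(s_t,\nu_t,t)(q_t^o)^2,$$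 which equals the value function of an inactive trader (one who makes no trades in stock or option, so that the inventories stay equal to $q_t^s,q_t^o$ on $[t,T]$), and the exact value function satisfies $$V(s_t,\nu_t,q_t^s,q_t^o,t)\ge\tilde V(s_t,\nu_t,q_t^s,q_t^o,t).$$
   Context: Model. $dS_t=\sqrt{\nu_t}\,dW_t$, $d\nu_t=\theta(\alpha-\nu_t)dt+\xi\sqrt{\nu_t}\,dB_t$, with constants $\theta,\alpha,\xi>0$, $\nu\ge0$, $W=\rho B+\sqrt{1-\rho^2}\,\tilde B$, where $B,\tilde B$ are independent standard Brownian motions. $E_t[\cdot]=E[\cdot\mid\mathcal F_t]$ (with $S_t=s_t$). The interest rate is $0$. $C(s,\nu,t)$ is the mid-price function of a European call with maturity $T$ and strike $K$, a smooth solution of $C_t+\frac12\nu C_{ss}+\xi\rho\nu C_{s\nu}+\frac12\xi^2\nu C_{\nu\nu}+[\theta(\alpha-\nu)-\lambda^\nu(s,\nu,t)]C_\nu=0$, $C(s,\nu,T)=(s-K)^+$, where $\lambda^\nu$ is a given price of volatility risk; $\Delta_t=C_s(S_t,\nu_t,t)$ and $C_\nu=\partial C/\partial\nu$. The expectations in the statement are assumed finite. A dealer makes markets in both stock ($s$) and option ($o$), choosing real-valued state-feedback premiums $\delta^{a,s},\delta^{b,s},\delta^{a,o},\delta^{b,o}$ around the mid-prices. The numbers of units sold/bought $N^{a,s},N^{b,s},N^{a,o},N^{b,o}$ are independent (conditionally on the controls) Poisson-type counting processes, independent of the Brownian motions, with intensities $\lambda^{a,s}(\delta_t^{a,s})$,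 etc. Inventories are the integer-valued processes with $dq^s=dN^{b,s}-dN^{a,s}$, $dq^o=dN^{b,o}-dN^{a,o}$. $\gamma\ge0$ is a constant. Value function: $$V(s_t,\nu_t,q_t^s,q_t^o,t)=\max E_t\Big[\int_t^T\delta_u^{a,s}dN_u^{a,s}+\delta_u^{b,s}dN_u^{b,s}+\delta_u^{a,o}dN_u^{a,o}+\delta_u^{b,o}dN_u^{b,o}-\frac{\gamma}{2}\int_t^T G_u\,\nu_u\,du\Big],$$ $$G_u=(q_u^s)^2+2q_u^sq_u^o(\Delta_u+\rho\xi C_\nu)+(q_u^o)^2(\Delta_u^2+2\rho\xi\Delta_uC_\nu+\xi^2C_\nu^2),$$ the maximum being over the four premium processes on $[t,T]$. $V$ is assumed to be of class $\mathcal C^{1,2,2}$ in $(t,s,\nu)$. For the exponential intensities the exact optimal premiums are $\delta_{t,*}^{a,s}=\frac1k+V(s,\nu,q^s,q^o,t)-V(s,\nu,q^s-1,q^o,t)$, $\delta_{t,*}^{b,s}=\frac1k+V(s,\nu,q^s,q^o,t)-V(s,\nu,q^s+1,q^o,t)$, $\delta_{t,*}^{a,o}=\frac1k+V(s,\nu,q^s,q^o,t)-V(s,\nu,q^s,q^o-1,t)$, $\delta_{t,*}^{b,o}=\frac1k+V(s,\nu,q^s,q^o,t)-V(s,\nu,q^s,q^o+1,t)$, and $V$ satisfies, with $G=(q^s)^2+2q^sq^o(C_s+\rho\xi C_\nu)+(q^o)^2(C_s^2+2\rho\xi C_sC_\nu+\xi^2C_\nu^2)$, $$V_t+\theta(\alpha-\nu)V_\nu+\tfrac12\nu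 V_{ss}+\rho\xi\nu V_{s\nu}+\tfrac12\xi^2\nu V_{\nu\nu}-\tfrac\gamma2\nu G+\tfrac Ak\left(e^{-k\delta_{t,*}^{a,s}}+e^{-k\delta_{t,*}^{b,s}}+e^{-k\delta_{t,*}^{a,o}}+e^{-k\delta_{t,*}^{b,o}}\right)=0,\quad V|_{t=T}=0.\quad( * )$$ Approximate treatment (following Avellaneda and Stoikov, 2008): (1) replace $V$ by a quadratic polynomial $\tilde V=a+b_1q^s+b_2q^o+c_1(q^s)^2+c_2q^sq^o+c_3(q^o)^2$ with coefficients depending on $(s,\nu,t)$ and with the convention $a\equiv0$; (2) in $( * )$ replace the order arrival term by its first-order expansion $\frac Ak\left(4-k(\delta_{t,*}^{a,s}+\delta_{t,*}^{b,s}+\delta_{t,*}^{a,o}+\delta_{t,*}^{b,o})\right)$, the premiums being computed with $\tilde V$ in place of $V$; (3) determine $b_1,b_2,c_1,c_2,c_3$ by equating to zero the coefficients of $q^s,q^o,(q^s)^2,q^sq^o,(q^o)^2$ in the resulting equation, with zero terminal conditions at $T$, taking the solutions given by the Feynman-Kac representation. The approximate policy is obtained by replacing $V$ with $\tilde V$ in the formulas for the optimal premiums. *)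

theory Defs
  imports "HOL-Probability.Probability"
begin

section \<open>Partial derivatives of functions of (s, v, t)\<close>

type_synonym field = "real \<Rightarrow> real \<Rightarrow> real \<Rightarrow> real"

definition Ds :: "field \<Rightarrow> field" where "Ds f s v t = deriv (\<lambda>x. f x v t) s"
definition Dv :: "field \<Rightarrow> field" where "Dv f s v t = deriv (\<lambda>x. f s x t) v"
definition Dt :: "field \<Rightarrow> field" where "Dt f s v t = deriv (\<lambda>x. f s v x) t"

text \<open>Class C122 on the interior: stock price unrestricted, positive variance, time in (0,T).
  Nothing is asked at the degenerate boundary v = 0.\<close>

definition C122 :: "real \<Rightarrow> field \<Rightarrow> bool" where
  "C122 T f \<longleftrightarrow>
     (\<forall>s v t. 0 < v \<and> 0 < t \<and> t < T \<longrightarrow>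
        (\<lambda>x. f s v x) differentiable (at t) \<and>
        (\<forall>g\<in>{f, Ds f, Dv f}. (\<lambda>x. g x v t) differentiable (at s) \<and>
                                (\<lambda>x. g s x t) differentiable (at v))) \<and>
     (\<forall>g\<in>{f, Dt f, Ds f, Dv f, Ds (Ds f), Dv (Ds f), Ds (Dv f), Dv (Dv f)}.
        continuous_on (UNIV \<times> {0<..} \<times> {0<..<T}) (\<lambda>(s, v, t). g s v t))"

section \<open>Stochastic calculus\<close>

definition conv_in_prob :: "'w measure \<Rightarrow> (nat \<Rightarrow> 'w \<Rightarrow> real) \<Rightarrow> ('w \<Rightarrow> real) \<Rightarrow> bool" where
  "conv_in_prob M Z Z0 \<longleftrightarrow>
     (\<forall>e>0. (\<lambda>n. measure M {w \<in> space M. e < \<bar>Z n w - Z0 w\<bar>}) \<longlonglongrightarrow> 0)"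

text \<open>\<open>B\<close>, \<open>B'\<close>: independent standard Brownian motions relative to the filtration \<open>F\<close>, i.e.
  the increments over [a,b] are centred normal with variance b - a, and they are independent of
  each other and of \<open>F a\<close>.\<close>

definition brownian_pair ::
  "'w measure \<Rightarrow> (real \<Rightarrow> 'w measure) \<Rightarrow> (real \<Rightarrow> 'w \<Rightarrow> real) \<Rightarrow> (real \<Rightarrow> 'w \<Rightarrow> real) \<Rightarrow> bool" where
  "brownian_pair M F B B' \<longleftrightarrow>
     (\<forall>X\<in>{B, B'}.
        (\<forall>t\<ge>0. X t \<in> borel_measurable (F t)) \<and>
        (AE w in M. X 0 w = 0 \<and> continuous_on {0..} (\<lambda>t. X t w)) \<and>
        (\<forall>a b. 0 \<le> a \<and> a < b \<longrightarrow>
           distributed M lborel (\<lambda>w. X b w - X a w)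
             (\<lambda>x. ennreal (normal_density 0 (sqrt (b - a)) x)))) \<and>
     (\<forall>a b. 0 \<le> a \<and> a < b \<longrightarrow>
        prob_space.indep_sets M
          (\<lambda>j. [sets (F a),
                sets (vimage_algebra (space M) (\<lambda>w. B b w - B a w) borel),
                sets (vimage_algebra (space M) (\<lambda>w. B' b w - B' a w) borel)] ! j) {..<3})"

text \<open>\<open>J\<close> is (a version of) the Ito integral of \<open>X\<close> against the \<open>F\<close>-Brownian motion \<open>W\<close> over [a,b].
  It is the limit in probability of the elementary integrals of bounded simple predictable
  processes whose squared L2(dr) distance to the path of \<open>X\<close> tends to 0 in probability.
  It is used below only for adapted \<open>X\<close> with continuous paths, for which the limit exists
  and does not depend on the approximating sequence.\<close>

definition ito_integral ::
  "'w measure \<Rightarrow> (real \<Rightarrow> 'w measure) \<Rightarrow> (real \<Rightarrow> 'w \<Rightarrow> real) \<Rightarrow> (real \<Rightarrow> 'w \<Rightarrow> real)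
    \<Rightarrow> real \<Rightarrow> real \<Rightarrow> ('w \<Rightarrow> real) \<Rightarrow> bool" where
  "ito_integral M F W X a b J \<longleftrightarrow>
     J \<in> borel_measurable M \<and>
     (\<exists>(m :: nat \<Rightarrow> nat) (\<tau> :: nat \<Rightarrow> nat \<Rightarrow> real) (\<zeta> :: nat \<Rightarrow> nat \<Rightarrow> 'w \<Rightarrow> real).
        (\<forall>n. \<tau> n 0 = a \<and> \<tau> n (m n) = b \<and>
             (\<forall>i<m n. \<tau> n i \<le> \<tau> n (Suc i) \<and> \<zeta> n i \<in> borel_measurable (F (\<tau> n i)) \<and>
                      (\<exists>c. \<forall>w\<in>space M. \<bar>\<zeta> n i w\<bar> \<le> c))) \<and>
        conv_in_prob M
          (\<lambda>n w. (LINT r:{a..b}|lborel.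
             (X r w - (\<Sum>i<m n. \<zeta> n i w * indicator {\<tau> n i<..\<tau> n (Suc i)} r))\<^sup>2)) (\<lambda>_. 0) \<and>
        conv_in_prob M
          (\<lambda>n w. \<Sum>i<m n. \<zeta> n i w * (W (\<tau> n (Suc i)) w - W (\<tau> n i) w)) J)"

definition history :: "'w measure \<Rightarrow> (real \<Rightarrow> 'w \<Rightarrow> nat) \<Rightarrow> real set \<Rightarrow> 'w set set" where
  "history M Y R = sigma_sets (space M) {Y r -` A \<inter> space M | r A. r \<in> R}"

definition unit_poisson_process :: "'w measure \<Rightarrow> (real \<Rightarrow> 'w \<Rightarrow> nat) \<Rightarrow> bool" where
  "unit_poisson_process M Y \<longleftrightarrow>
     (\<forall>u\<ge>0. Y u \<in> measurable M (count_space UNIV)) \<and>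
     (\<forall>w\<in>space M. Y 0 w = 0 \<and> mono_on {0..} (\<lambda>u. Y u w) \<and>
        (\<forall>u\<ge>0. continuous (at_right u) (\<lambda>r. Y r w))) \<and>
     (\<forall>a b. 0 \<le> a \<and> a < b \<longrightarrow>
        distr M (count_space UNIV) (\<lambda>w. Y b w - Y a w) = measure_pmf (poisson_pmf (b - a)) \<and>
        prob_space.indep_set M (history M Y {0..a})
          (sets (vimage_algebra (space M) (\<lambda>w. Y b w - Y a w) (count_space UNIV))))"

section \<open>The market model\<close>

text \<open>\<open>AskS\<close>: the dealer sells one share, \<open>BidS\<close>: buys one share; \<open>AskO\<close>, \<open>BidO\<close> likewise for
  the option.\<close>

datatype quote = AskS | BidS | AskO | BidO

definition quotes :: "quote set" where "quotes = {AskS, BidS, AskO, BidO}"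

text \<open>\<open>vol m t v u\<close> and \<open>stock m t s v u\<close> are the variance and the stock price at time \<open>u\<close> when
  they are started at time \<open>t\<close> from \<open>v\<close> and \<open>s\<close>.  Conditional expectations at time \<open>t\<close> given the
  state (s, v) are expectations over these processes.  \<open>clock m i\<close> are the unit-rate Poisson
  processes that drive the order arrivals and \<open>intensity m i\<close> the intensity as a function of the
  premium.\<close>

record 'w model =
  prb :: "'w measure"
  filt :: "real \<Rightarrow> 'w measure"
  bm :: "real \<Rightarrow> 'w \<Rightarrow> real"
  bm' :: "real \<Rightarrow> 'w \<Rightarrow> real"
  vol :: "real \<Rightarrow> real \<Rightarrow> real \<Rightarrow> 'w \<Rightarrow> real"
  stock :: "real \<Rightarrow> real \<Rightarrow> real \<Rightarrow> real \<Rightarrow> 'w \<Rightarrow> real"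
  clock :: "quote \<Rightarrow> real \<Rightarrow> 'w \<Rightarrow> nat"
  theta :: real
  alpha :: real
  xi :: real
  rho :: real
  gam :: real
  horizon :: real
  strike :: real
  call :: field
  risk_price :: field
  intensity :: "quote \<Rightarrow> real \<Rightarrow> real"

definition heston_dynamics :: "('w, 'z) model_scheme \<Rightarrow> bool" where
  "heston_dynamics m \<longleftrightarrow>
     (\<forall>t s v. 0 \<le> t \<and> t \<le> horizon m \<and> 0 \<le> v \<longrightarrow>
        (\<forall>u\<in>{t..horizon m}. vol m t v u \<in> borel_measurable (filt m u) \<and>
                             stock m t s v u \<in> borel_measurable (filt m u)) \<and>
        (\<forall>w\<in>space (prb m).
           continuous_on {t..horizon m} (\<lambda>u. vol m t v u w) \<and>
           continuous_on {t..horizon m} (\<lambda>u. stock m t s v u w) \<and>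
           (\<forall>u\<in>{t..horizon m}. 0 \<le> vol m t v u w)) \<and>
        (\<forall>u\<in>{t..horizon m}.
           (\<exists>J. ito_integral (prb m) (filt m) (bm m) (\<lambda>r w. sqrt (vol m t v r w)) t u J \<and>
              (AE w in prb m. vol m t v u w =
                 v + (LINT r:{t..u}|lborel. theta m * (alpha m - vol m t v r w)) + xi m * J w)) \<and>
           (\<exists>J. ito_integral (prb m) (filt m)
                  (\<lambda>r w. rho m * bm m r w + sqrt (1 - (rho m)\<^sup>2) * bm' m r w)
                  (\<lambda>r w. sqrt (vol m t v r w)) t u J \<and>
              (AE w in prb m. stock m t s v u w = s + J w))))"

definition call_price :: "('w, 'z) model_scheme \<Rightarrow> bool" where
  "call_price m \<longleftrightarrow> (let C = call m in
     C122 (horizon m) C \<and>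
     continuous_on (UNIV \<times> {0<..} \<times> {0<..horizon m}) (\<lambda>(s, v, t). C s v t) \<and>
     (\<forall>s v t. 0 < v \<and> 0 < t \<and> t < horizon m \<longrightarrow>
        Dt C s v t + 1/2 * v * Ds (Ds C) s v t + xi m * rho m * v * Dv (Ds C) s v t
        + 1/2 * (xi m)\<^sup>2 * v * Dv (Dv C) s v t
        + (theta m * (alpha m - v) - risk_price m s v t) * Dv C s v t = 0) \<and>
     (\<forall>s v. 0 \<le> v \<longrightarrow> C s v (horizon m) = max (s - strike m) 0))"

definition market_model :: "('w, 'z) model_scheme \<Rightarrow> bool" where
  "market_model m \<longleftrightarrow>
     theta m > 0 \<and> alpha m > 0 \<and> xi m > 0 \<and> -1 \<le> rho m \<and> rho m \<le> 1 \<and> gam m \<ge> 0 \<and>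
     horizon m > 0 \<and>
     prob_space (prb m) \<and>
     filtration (space (prb m)) (filt m) \<and> (\<forall>t. sets (filt m t) \<subseteq> sets (prb m)) \<and>
     brownian_pair (prb m) (filt m) (bm m) (bm' m) \<and>
     heston_dynamics m \<and> call_price m \<and>
     (\<forall>i. unit_poisson_process (prb m) (clock m i)) \<and>
     prob_space.indep_sets (prb m)
       (\<lambda>j. case j of None \<Rightarrow> sets (filt m (horizon m))
                     | Some i \<Rightarrow> history (prb m) (clock m i) {0..}) UNIV"

section \<open>The control problem\<close>

type_synonym policy = "quote \<Rightarrow> real \<Rightarrow> real \<Rightarrow> int \<Rightarrow> int \<Rightarrow> real \<Rightarrow> real"
type_synonym 'w flow = "quote \<Rightarrow> real \<Rightarrow> 'w \<Rightarrow> nat"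

definition inv_stock :: "int \<Rightarrow> 'w flow \<Rightarrow> real \<Rightarrow> 'w \<Rightarrow> int" where
  "inv_stock qs N u w = qs + int (N BidS u w) - int (N AskS u w)"

definition inv_option :: "int \<Rightarrow> 'w flow \<Rightarrow> real \<Rightarrow> 'w \<Rightarrow> int" where
  "inv_option qo N u w = qo + int (N BidO u w) - int (N AskO u w)"

definition left_lim :: "(real \<Rightarrow> int) \<Rightarrow> real \<Rightarrow> int" where
  "left_lim q u = Lim (at_left u) q"

text \<open>Premium quoted at time \<open>u\<close>: it depends on the inventories just before \<open>u\<close>.\<close>

definition premium_path ::
  "('w, 'z) model_scheme \<Rightarrow> real \<Rightarrow> real \<Rightarrow> int \<Rightarrow> int \<Rightarrow> real \<Rightarrow> policy \<Rightarrow> 'w flow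
    \<Rightarrow> quote \<Rightarrow> real \<Rightarrow> 'w \<Rightarrow> real" where
  "premium_path m s v qs qo t \<phi> N i u w =
     \<phi> i (stock m t s v u w) (vol m t v u w)
       (left_lim (\<lambda>r. inv_stock qs N r w) u) (left_lim (\<lambda>r. inv_option qo N r w) u) u"

text \<open>Order arrivals under the policy \<open>\<phi>\<close>: the counting process \<open>N i\<close> is the unit Poisson process
  \<open>clock m i\<close> run with the accumulated intensity of the quoted premiums, so it has stochastic
  intensity \<open>intensity m i\<close> at the current premium.  For \<open>u < t\<close> the integral is 0 and so is
  \<open>N i u\<close>; after the horizon \<open>N i\<close> stays constant.\<close>

definition order_flow ::
  "('w, 'z) model_scheme \<Rightarrow> real \<Rightarrow> real \<Rightarrow> int \<Rightarrow> int \<Rightarrow> real \<Rightarrow> policy \<Rightarrow> 'w flow \<Rightarrow> bool" where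
  "order_flow m s v qs qo t \<phi> N \<longleftrightarrow>
     (\<forall>i u. N i u \<in> measurable (prb m) (count_space UNIV)) \<and>
     (\<forall>i. AE w in prb m.
        set_integrable lborel {t..horizon m}
          (\<lambda>r. intensity m i (premium_path m s v qs qo t \<phi> N i r w)) \<and>
        (\<forall>u. N i u w = clock m i
           (LINT r:{t..min u (horizon m)}|lborel.
              intensity m i (premium_path m s v qs qo t \<phi> N i r w)) w))"

definition risk :: "('w, 'z) model_scheme \<Rightarrow> real \<Rightarrow> real \<Rightarrow> real \<Rightarrow> int \<Rightarrow> int \<Rightarrow> real" where
  "risk m s v t x y = (let Cs = Ds (call m) s v t; Cv = Dv (call m) s v t in
     (of_int x)\<^sup>2 + 2 * of_int x * of_int y * (Cs + rho m * xi m * Cv)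
     + (of_int y)\<^sup>2 * (Cs\<^sup>2 + 2 * rho m * xi m * Cs * Cv + (xi m)\<^sup>2 * Cv\<^sup>2))"

definition risk_path ::
  "('w, 'z) model_scheme \<Rightarrow> real \<Rightarrow> real \<Rightarrow> int \<Rightarrow> int \<Rightarrow> real \<Rightarrow> 'w flow \<Rightarrow> real \<Rightarrow> 'w \<Rightarrow> real" where
  "risk_path m s v qs qo t N u w =
     risk m (stock m t s v u w) (vol m t v u w) u (inv_stock qs N u w) (inv_option qo N u w)
     * vol m t v u w"

definition payoff ::
  "('w, 'z) model_scheme \<Rightarrow> real \<Rightarrow> real \<Rightarrow> int \<Rightarrow> int \<Rightarrow> real \<Rightarrow> policy \<Rightarrow> 'w flow \<Rightarrow> 'w \<Rightarrow> real" where
  "payoff m s v qs qo t \<phi> N w =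
     (\<Sum>i\<in>quotes. (LINT u:{t<..horizon m}|interval_measure (\<lambda>u. real (N i u w)).
                     premium_path m s v qs qo t \<phi> N i u w))
     - gam m / 2 * (LINT u:{t..horizon m}|lborel. risk_path m s v qs qo t N u w)"

definition objective ::
  "('w, 'z) model_scheme \<Rightarrow> real \<Rightarrow> real \<Rightarrow> int \<Rightarrow> int \<Rightarrow> real \<Rightarrow> policy \<Rightarrow> 'w flow \<Rightarrow> real" where
  "objective m s v qs qo t \<phi> N = (LINT w|prb m. payoff m s v qs qo t \<phi> N w)"

text \<open>The integrability clauses ensure that the payoff and its expectation are genuine.\<close>

definition admissible ::
  "('w, 'z) model_scheme \<Rightarrow> real \<Rightarrow> real \<Rightarrow> int \<Rightarrow> int \<Rightarrow> real \<Rightarrow> policy \<Rightarrow> 'w flow \<Rightarrow> bool" where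
  "admissible m s v qs qo t \<phi> N \<longleftrightarrow>
     (\<forall>i x y. (\<lambda>(s, v, u). \<phi> i s v x y u) \<in> borel_measurable borel) \<and>
     order_flow m s v qs qo t \<phi> N \<and>
     (AE w in prb m. set_integrable lborel {t..horizon m}
        (\<lambda>u. risk_path m s v qs qo t N u w)) \<and>
     integrable (prb m) (payoff m s v qs qo t \<phi> N)"

definition is_value_function ::
  "('w, 'z) model_scheme \<Rightarrow> (real \<Rightarrow> real \<Rightarrow> int \<Rightarrow> int \<Rightarrow> real \<Rightarrow> real) \<Rightarrow> bool" where
  "is_value_function m V \<longleftrightarrow>
     (\<forall>s v qs qo t. 0 \<le> v \<and> 0 \<le> t \<and> t \<le> horizon m \<longrightarrow>
        (\<exists>\<phi> N. admissible m s v qs qo t \<phi> N \<and> V s v qs qo t = objective m s v qs qo t \<phi> N) \<and>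
        (\<forall>\<phi> N. admissible m s v qs qo t \<phi> N \<longrightarrow> objective m s v qs qo t \<phi> N \<le> V s v qs qo t))"

text \<open>No trades at all: the order flow is identically 0, so the premiums (put to 0 here) are never
  collected.\<close>

definition inactive_value ::
  "('w, 'z) model_scheme \<Rightarrow> real \<Rightarrow> real \<Rightarrow> int \<Rightarrow> int \<Rightarrow> real \<Rightarrow> real" where
  "inactive_value m s v qs qo t =
     objective m s v qs qo t (\<lambda>_ _ _ _ _ _. 0) (\<lambda>_ _ _. 0)"

section \<open>Running expectations\<close>

text \<open>\<open>running m f s v t\<close> is the expectation, given the state (s, v) at time \<open>t\<close>, of the integral
  of \<open>f\<close> along the state process from \<open>t\<close> to the horizon.\<close>

definition running :: "('w, 'z) model_scheme \<Rightarrow> field \<Rightarrow> field" where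
  "running m f s v t =
     (LINT w|prb m. (LINT u:{t..horizon m}|lborel. f (stock m t s v u w) (vol m t v u w) u))"

definition finite_running :: "('w, 'z) model_scheme \<Rightarrow> field \<Rightarrow> bool" where
  "finite_running m f \<longleftrightarrow>
     (\<forall>s v t. 0 \<le> v \<and> 0 \<le> t \<and> t \<le> horizon m \<longrightarrow>
        integrable (prb m \<Otimes>\<^sub>M lborel)
          (\<lambda>(w, u). indicator {t..horizon m} u * f (stock m t s v u w) (vol m t v u w) u))"

definition cross_risk :: "('w, 'z) model_scheme \<Rightarrow> field" where
  "cross_risk m s v t = v * (Ds (call m) s v t + rho m * xi m * Dv (call m) s v t)"

definition option_risk :: "('w, 'z) model_scheme \<Rightarrow> field" where
  "option_risk m s v t =
     v * ((Ds (call m) s v t)\<^sup>2 + 2 * rho m * xi m * Ds (call m) s v t * Dv (call m) s v t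
          + (xi m)\<^sup>2 * (Dv (call m) s v t)\<^sup>2)"

definition H1 :: "('w, 'z) model_scheme \<Rightarrow> field" where
  "H1 m s v t = - gam m * running m (cross_risk m) s v t"

definition H2 :: "('w, 'z) model_scheme \<Rightarrow> field" where
  "H2 m s v t = - gam m / 2 * running m (option_risk m) s v t"

section \<open>The approximate treatment\<close>

text \<open>The premiums computed from a candidate value function \<open>U\<close> through the formulas for the
  optimal premiums.\<close>

fun premium :: "real \<Rightarrow> (real \<Rightarrow> real \<Rightarrow> int \<Rightarrow> int \<Rightarrow> real \<Rightarrow> real) \<Rightarrow> policy" where
  "premium k U AskS s v qs qo t = 1 / k + U s v qs qo t - U s v (qs - 1) qo t"
| "premium k U BidS s v qs qo t = 1 / k + U s v qs qo t - U s v (qs + 1) qo t"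
| "premium k U AskO s v qs qo t = 1 / k + U s v qs qo t - U s v qs (qo - 1) t"
| "premium k U BidO s v qs qo t = 1 / k + U s v qs qo t - U s v qs (qo + 1) t"

definition ansatz ::
  "field \<Rightarrow> field \<Rightarrow> field \<Rightarrow> field \<Rightarrow> field \<Rightarrow> real \<Rightarrow> real \<Rightarrow> int \<Rightarrow> int \<Rightarrow> real \<Rightarrow> real" where
  "ansatz b1 b2 c1 c2 c3 s v qs qo t =
     b1 s v t * of_int qs + b2 s v t * of_int qo + c1 s v t * (of_int qs)\<^sup>2
     + c2 s v t * of_int qs * of_int qo + c3 s v t * (of_int qo)\<^sup>2"

text \<open>The differential part of the dynamic programming equation.\<close>

definition gen :: "('w, 'z) model_scheme \<Rightarrow> field \<Rightarrow> field" where
  "gen m f s v t =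
     Dt f s v t + theta m * (alpha m - v) * Dv f s v t + 1/2 * v * Ds (Ds f) s v t
     + rho m * xi m * v * Dv (Ds f) s v t + 1/2 * (xi m)\<^sup>2 * v * Dv (Dv f) s v t"

text \<open>The part without derivatives, the order arrival term being replaced by its first-order
  expansion in the premiums.\<close>

definition linearised_source ::
  "('w, 'z) model_scheme \<Rightarrow> real \<Rightarrow> real \<Rightarrow> (real \<Rightarrow> real \<Rightarrow> int \<Rightarrow> int \<Rightarrow> real \<Rightarrow> real)
    \<Rightarrow> real \<Rightarrow> real \<Rightarrow> int \<Rightarrow> int \<Rightarrow> real \<Rightarrow> real" where
  "linearised_source m A k U s v qs qo t =
     - gam m / 2 * v * risk m s v t qs qo
     + A / k * (4 - k * (\<Sum>i\<in>quotes. premium k U i s v qs qo t))"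

definition linearised_equation ::
  "('w, 'z) model_scheme \<Rightarrow> real \<Rightarrow> real \<Rightarrow> (real \<Rightarrow> real \<Rightarrow> int \<Rightarrow> int \<Rightarrow> real \<Rightarrow> real)
    \<Rightarrow> real \<Rightarrow> real \<Rightarrow> int \<Rightarrow> int \<Rightarrow> real \<Rightarrow> real" where
  "linearised_equation m A k U s v qs qo t =
     gen m (\<lambda>s v t. U s v qs qo t) s v t + linearised_source m A k U s v qs qo t"

text \<open>\<open>has_coeffs f a0 a1 a2 a11 a12 a22\<close>: \<open>f\<close> is a quadratic polynomial in the two inventories with
  these coefficients (they are unique).\<close>

definition has_coeffs ::
  "(int \<Rightarrow> int \<Rightarrow> real) \<Rightarrow> real \<Rightarrow> real \<Rightarrow> real \<Rightarrow> real \<Rightarrow> real \<Rightarrow> real \<Rightarrow> bool" where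
  "has_coeffs f a0 a1 a2 a11 a12 a22 \<longleftrightarrow>
     (\<forall>x y. f x y = a0 + a1 * of_int x + a2 * of_int y + a11 * (of_int x)\<^sup>2
                    + a12 * of_int x * of_int y + a22 * (of_int y)\<^sup>2)"

text \<open>All coefficients of the resulting equation except the constant one vanish.\<close>

definition coefficient_equations ::
  "('w, 'z) model_scheme \<Rightarrow> real \<Rightarrow> real \<Rightarrow> field \<Rightarrow> field \<Rightarrow> field \<Rightarrow> field \<Rightarrow> field \<Rightarrow> bool" where
  "coefficient_equations m A k b1 b2 c1 c2 c3 \<longleftrightarrow>
     (\<forall>s v t. 0 < v \<and> 0 < t \<and> t < horizon m \<longrightarrow>
        (\<exists>a0. has_coeffs
           (\<lambda>qs qo. linearised_equation m A k (ansatz b1 b2 c1 c2 c3) s v qs qo t) a0 0 0 0 0 0))"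

text \<open>\<open>f\<close> is the solution of \<open>gen m f + g = 0\<close>, \<open>f = 0\<close> at the horizon, that the Feynman-Kac
  representation gives.\<close>

definition feynman_kac :: "('w, 'z) model_scheme \<Rightarrow> field \<Rightarrow> field \<Rightarrow> bool" where
  "feynman_kac m f g \<longleftrightarrow>
     (\<forall>s v t. 0 \<le> v \<and> 0 \<le> t \<and> t \<le> horizon m \<longrightarrow> f s v t = running m g s v t)"

text \<open>The coefficient of each monomial in the resulting equation is \<open>gen m\<close> of the corresponding
  coefficient function of the ansatz plus the coefficient of that monomial in the part without
  derivatives; the latter is the source of the Feynman-Kac representation.  The Feynman-Kac
  functions need not be differentiable for every call price function, and then the coefficient
  equations have no classical meaning; they are therefore imposed pointwise as soon as the
  coefficient functions are of class C122.  Dropping that proviso only shrinks the set of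
  coefficient functions described here.\<close>

definition approximate_treatment ::
  "('w, 'z) model_scheme \<Rightarrow> real \<Rightarrow> real \<Rightarrow> field \<Rightarrow> field \<Rightarrow> field \<Rightarrow> field \<Rightarrow> field \<Rightarrow> bool" where
  "approximate_treatment m A k b1 b2 c1 c2 c3 \<longleftrightarrow>
     ((\<forall>f\<in>{b1, b2, c1, c2, c3}. C122 (horizon m) f) \<longrightarrow>
        coefficient_equations m A k b1 b2 c1 c2 c3) \<and>
     (\<forall>f\<in>{b1, b2, c1, c2, c3}. \<forall>s v. 0 \<le> v \<longrightarrow> f s v (horizon m) = 0) \<and>
     (\<exists>g0 g1 g2 g11 g12 g22.
        (\<forall>s v t. 0 \<le> v \<and> 0 \<le> t \<and> t \<le> horizon m \<longrightarrow>
           has_coeffs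
             (\<lambda>qs qo. linearised_source m A k (ansatz b1 b2 c1 c2 c3) s v qs qo t)
             (g0 s v t) (g1 s v t) (g2 s v t) (g11 s v t) (g12 s v t) (g22 s v t)) \<and>
        feynman_kac m b1 g1 \<and> feynman_kac m b2 g2 \<and>
        feynman_kac m c1 g11 \<and> feynman_kac m c2 g12 \<and> feynman_kac m c3 g22)"

section \<open>The closed forms\<close>

definition stock_term :: "('w, 'z) model_scheme \<Rightarrow> real \<Rightarrow> real \<Rightarrow> real" where
  "stock_term m v t =
     gam m / (2 * theta m) * (v - alpha m) * (1 - exp (- theta m * (horizon m - t)))
     + gam m / 2 * alpha m * (horizon m - t)"

definition approx_value ::
  "('w, 'z) model_scheme \<Rightarrow> real \<Rightarrow> real \<Rightarrow> int \<Rightarrow> int \<Rightarrow> real \<Rightarrow> real" where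
  "approx_value m s v qs qo t =
     - stock_term m v t * (of_int qs)\<^sup>2 + H1 m s v t * of_int qs * of_int qo
     + H2 m s v t * (of_int qo)\<^sup>2"

end

theory Submission
  imports Defs
begin

text \<open>The arrival term linearised in the premiums sees only the second differences of the quadratic
  ansatz, so it feeds only the constant coefficient; the sources of the other coefficients are the
  coefficients of the running risk.  Hence the approximate value is the expected accumulated risk at
  frozen inventories, which is the value of the inactive trader.

  The closed form of the stock term needs the mean of the variance process, that is, that the Ito
  integral of the square root of the variance is centred.  Take simple processes \<open>K n\<close> with
  \<open>D n = \<integral>(X - K n)\<^sup>2\<close> tending to 0 fast in probability, and stop \<open>K n\<close> as soon as
  its accumulated square exceeds \<open>n\<close>.  Along a subsequence the second moments of the stopped
  integrals are bounded, since \<open>min n (\<integral>(K n)\<^sup>2) \<le> 2 \<integral>X\<^sup>2 + 2 min n (D n)\<close>,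
  and the stopped integrals still converge almost surely to the Ito integral, so the means converge.

  Exponential intensities never vanish, so no admissible policy is inactive.  The lower bound
  for the exact value function comes from quoting a large constant premium \<open>n\<close>: the collected premiums
  are nonnegative, and the accumulated risk converges to that of the inactive trader by dominated
  convergence, because the driving Poisson clocks have second moments and are independent of the
  market.\<close>

section \<open>Measurability and convergence\<close>

lemma tendsto_right_continuous:
  fixes f :: "real \<Rightarrow> real"
  assumes "continuous (at_right a) f" "X \<longlonglongrightarrow> a" "\<And>n. a \<le> X n"
  shows "(\<lambda>n. f (X n)) \<longlonglongrightarrow> f a"
proof -
  \<comment> \<open>Including the point \<open>a\<close> itself allows sequences some of whose terms
    equal \<open>a\<close>.\<close>
  have "continuous (at a within {a..}) f"
    using assms(1) unfolding continuous_within at_within_Ici_at_right .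
  then show ?thesis
    using assms(2,3) by (auto simp: continuous_within_sequentially o_def)
qed

text \<open>Time is rounded up to a grid of mesh \<open>1 / Suc n\<close>. The rounded process takes
  countably many time values, so it is jointly measurable, and right continuity makes it converge to
  \<open>Y\<close>. Using \<open>max c u\<close> extends the process constantly to the left of
  \<open>c\<close>, so that no restriction of the time axis is required.\<close>

lemma borel_measurable_right_continuous_paths:
  fixes Y :: "real \<Rightarrow> 'w \<Rightarrow> real"
  assumes meas: "\<And>u. c \<le> u \<Longrightarrow> Y u \<in> borel_measurable N"
    and cont: "\<And>w u. w \<in> space N \<Longrightarrow> c \<le> u \<Longrightarrow> continuous (at_right u) (\<lambda>r. Y r w)"
  shows "(\<lambda>(w, u). Y (max c u) w) \<in> borel_measurable (N \<Otimes>\<^sub>M borel)"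
proof -
  \<comment> \<open>\<open>a n j\<close> is the right end point of the grid cell \<open>j\<close>,
    moved up to \<open>c\<close> if it lies below, and \<open>b n u\<close> is that end point for
    the cell that contains \<open>u\<close>.\<close>
  define a where "a n j = max c ((of_int j + 1) / real (Suc n))" for n and j :: int
  define b where "b n u = a n \<lfloor>u * real (Suc n)\<rfloor>" for n u
  have b: "max c u \<le> b n u \<and> b n u \<le> max c u + 1 / real (Suc n)" for n u
  proof -
    have "u \<le> (of_int \<lfloor>u * real (Suc n)\<rfloor> + 1) / real (Suc n)"
      by (simp add: pos_le_divide_eq del: of_nat_Suc)
    moreover have "(of_int \<lfloor>u * real (Suc n)\<rfloor> + 1) / real (Suc n) \<le> u + 1 / real (Suc n)"
      by (simp add: pos_divide_le_eq ring_distribs del: of_nat_Suc)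
    ultimately show ?thesis
      unfolding b_def a_def by (auto simp: max_def)
  qed
  have lim: "(\<lambda>n. b n u) \<longlonglongrightarrow> max c u" for u
  proof (rule tendsto_sandwich[of "\<lambda>_. max c u" _ _ "\<lambda>n. max c u + 1 / real (Suc n)"])
    have "(\<lambda>n. max c u + 1 / real (Suc n)) \<longlonglongrightarrow> max c u + 0"
      by (intro tendsto_intros LIMSEQ_Suc[OF lim_1_over_n])
    then show "(\<lambda>n. max c u + 1 / real (Suc n)) \<longlonglongrightarrow> max c u" by simp
    show "\<forall>\<^sub>F n in sequentially. max c u \<le> b n u"
      and "\<forall>\<^sub>F n in sequentially. b n u \<le> max c u + 1 / real (Suc n)"
      using b by simp_all
  qed simp
  show ?thesis
  proof (rule borel_measurable_LIMSEQ_real)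
    fix z :: "'w \<times> real" assume z: "z \<in> space (N \<Otimes>\<^sub>M borel)"
    obtain w u where wu: "z = (w, u)" by fastforce
    have "(\<lambda>n. Y (b n u) w) \<longlonglongrightarrow> Y (max c u) w"
      using z wu b by (intro tendsto_right_continuous[OF cont lim]) (auto simp: space_pair_measure)
    then show "(\<lambda>n. case z of (w, u) \<Rightarrow> Y (b n u) w) \<longlonglongrightarrow> (case z of (w, u) \<Rightarrow> Y (max c u) w)"
      by (simp add: wu)
  next
    have "(\<lambda>z. Y (a n \<lfloor>snd z * real (Suc n)\<rfloor>) (fst z)) \<in> borel_measurable (N \<Otimes>\<^sub>M borel)" for n
    proof (rule measurable_compose_countable[where f="\<lambda>j z. Y (a n j) (fst z)"])
      show "(\<lambda>z. Y (a n j) (fst z)) \<in> borel_measurable (N \<Otimes>\<^sub>M borel)" for j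
        by (rule measurable_compose[OF measurable_fst]) (auto intro: meas simp: a_def)
    qed measurable
    then show "(\<lambda>z. case z of (w, u) \<Rightarrow> Y (b n u) w) \<in> borel_measurable (N \<Otimes>\<^sub>M borel)" for n
      by (simp add: b_def split_beta')
  qed
qed

text \<open>The preimages of Borel sets already form a sigma-algebra, so the generated
  sigma-algebras in the characterisation of \<open>indep_var\<close> are classes of preimages and
  lie inside the two given independent classes.\<close>

lemma (in prob_space) indep_var_of_indep_set:
  assumes ind: "indep_set \<A> \<B>"
    and f: "f \<in> borel_measurable M" "\<And>A. A \<in> sets borel \<Longrightarrow> f -` A \<inter> space M \<in> \<A>"
    and g: "g \<in> borel_measurable M" "\<And>A. A \<in> sets borel \<Longrightarrow> g -` A \<inter> space M \<in> \<B>"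
  shows "indep_var borel (f :: 'a \<Rightarrow> real) borel (g :: 'a \<Rightarrow> real)"
proof -
  have gen: "sigma_sets (space M) {X -` A \<inter> space M | A. A \<in> sets borel} = {X -` A \<inter> space M | A. A \<in> sets borel}"
    for X :: "'a \<Rightarrow> real"
    using sigma_sets_vimage_commute[of X "space M" UNIV "sets borel"] sets.sigma_sets_eq[of "borel::real measure"]
    by (simp add: Pi_def)
  have "indep_set {f -` A \<inter> space M | A. A \<in> sets borel} {g -` A \<inter> space M | A. A \<in> sets borel}"
    using ind unfolding indep_set_def
    by (rule indep_sets_mono_sets) (use f(2) g(2) in \<open>auto split: bool.split\<close>)
  then show ?thesis
    unfolding indep_var_eq gen using f(1) g(1) by simp
qed

text \<open>Along a suitable subsequence the exceptional sets are summable, so Borel--Cantelli applies.\<close>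

lemma (in prob_space) conv_in_prob_subseq:
  assumes Z: "\<And>n. Z n \<in> borel_measurable M" "Z0 \<in> borel_measurable M" "conv_in_prob M Z Z0"
    and Y: "\<And>n. Y n \<in> borel_measurable M" "Y0 \<in> borel_measurable M" "conv_in_prob M Y Y0"
  shows "\<exists>r. (\<forall>n. prob {w \<in> space M. (1/2::real)^n < \<bar>Y (r n) w - Y0 w\<bar>} \<le> (1/2)^n) \<and>
     (AE w in M. (\<lambda>n. Z (r n) w) \<longlonglongrightarrow> Z0 w) \<and>
     (AE w in M. \<forall>\<^sub>F n in sequentially. \<bar>Y (r n) w - Y0 w\<bar> \<le> (1/2)^n)"
proof -
  \<comment> \<open>One index is chosen for both sequences, so that a single subsequence serves the
    integrals and their squared errors. Monotonicity of the selection is irrelevant for the argument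
    by summable probabilities.\<close>
  have "\<exists>j. prob {w \<in> space M. (1/2::real)^n < \<bar>Z j w - Z0 w\<bar>} < (1/2)^n \<and>
            prob {w \<in> space M. (1/2::real)^n < \<bar>Y j w - Y0 w\<bar>} < (1/2)^n" for n :: nat
  proof -
    have pos: "(0::real) < (1/2)^n" by simp
    have "\<forall>\<^sub>F j in sequentially. prob {w \<in> space M. (1/2::real)^n < \<bar>X j w - X0 w\<bar>} < (1/2)^n"
      if "conv_in_prob M X X0" for X X0
      using that[unfolded conv_in_prob_def, rule_format, OF pos] pos by (rule order_tendstoD(2))
    from eventually_conj[OF this[OF Z(3)] this[OF Y(3)]] show ?thesis
      by (intro eventually_happens'[of sequentially]) simp_all
  qed
  then have "\<exists>r. \<forall>n. prob {w \<in> space M. (1/2::real)^n < \<bar>Z (r n) w - Z0 w\<bar>} < (1/2)^n \<and>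
            prob {w \<in> space M. (1/2::real)^n < \<bar>Y (r n) w - Y0 w\<bar>} < (1/2)^n"
    by (intro choice allI)
  then obtain r where r: "\<And>n. prob {w \<in> space M. (1/2::real)^n < \<bar>Z (r n) w - Z0 w\<bar>} < (1/2)^n"
      "\<And>n. prob {w \<in> space M. (1/2::real)^n < \<bar>Y (r n) w - Y0 w\<bar>} < (1/2)^n"
    by blast
  have bc: "AE w in M. \<forall>\<^sub>F n in sequentially. \<bar>X n w - X0 w\<bar> \<le> (1/2::real)^n"
    if [measurable]: "\<And>n::nat. X n \<in> borel_measurable M" "X0 \<in> borel_measurable M"
      and p: "\<And>n. prob {w \<in> space M. (1/2::real)^n < \<bar>X n w - X0 w\<bar>} < (1/2)^n" for X X0
  proof -
    have "AE w in M. \<forall>\<^sub>F n in sequentially. w \<in> space M - {w \<in> space M. (1/2::real)^n < \<bar>X n w - X0 w\<bar>}"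
    proof (rule borel_cantelli_AE1)
      show "summable (\<lambda>n. prob {w \<in> space M. (1/2::real)^n < \<bar>X n w - X0 w\<bar>})"
        using p by (intro summable_comparison_test'[OF summable_geometric[of "1/2::real"], of 0]) (auto intro: less_imp_le)
    qed (auto simp: emeasure_eq_measure)
    then show ?thesis
      by eventually_elim (auto elim!: eventually_mono)
  qed
  have "AE w in M. (\<lambda>n. Z (r n) w) \<longlonglongrightarrow> Z0 w"
    using bc[OF Z(1)[of "r _"] Z(2) r(1)]
  proof eventually_elim
    case (elim w)
    have "(\<lambda>n. (1/2::real)^n) \<longlonglongrightarrow> 0" by (intro LIMSEQ_realpow_zero) auto
    then have "(\<lambda>n. Z (r n) w - Z0 w) \<longlonglongrightarrow> 0"
      by (rule Lim_null_comparison[rotated]) (use elim in simp)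
    then show ?case by (simp add: LIM_zero_iff)
  qed
  with r(2) bc[OF Y(1)[of "r _"] Y(2) r(2)] show ?thesis
    by (intro exI[of _ r]) (auto intro: less_imp_le)
qed

text \<open>Bounded second moments give uniform integrability, which upgrades almost sure
  convergence to convergence of the means. Fatou bounds the second moment of the limit, and the
  distance \<open>g n\<close> to the limit is truncated at a level \<open>K\<close> whose tail is
  controlled by Chebyshev's argument.\<close>

lemma (in prob_space) integral_tendsto_of_bounded_second_moment:
  fixes f :: "nat \<Rightarrow> 'a \<Rightarrow> real" and J :: "'a \<Rightarrow> real"
  assumes f: "\<And>n. f n \<in> borel_measurable M" "\<And>n. integrable M (\<lambda>w. (f n w)\<^sup>2)"
    and bound: "\<And>n. expectation (\<lambda>w. (f n w)\<^sup>2) \<le> C"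
    and J[measurable]: "J \<in> borel_measurable M"
    and lim: "AE w in M. (\<lambda>n. f n w) \<longlonglongrightarrow> J w"
  shows "integrable M J" "(\<lambda>n. expectation (f n)) \<longlonglongrightarrow> expectation J"
proof -
  note [measurable] = f(1)
  have L1: "integrable M g" if "g \<in> borel_measurable M" "integrable M (\<lambda>w. (g w)\<^sup>2)" for g :: "'a \<Rightarrow> real"
  proof (rule Bochner_Integration.integrable_bound)
    show "integrable M (\<lambda>w. 1 + (g w)\<^sup>2)" using that by simp
    have "\<bar>x\<bar> \<le> 1 + x\<^sup>2" for x :: real
      using zero_le_power2[of "\<bar>x\<bar> - 1"] by (simp add: power2_eq_square algebra_simps)
    then show "AE w in M. norm (g w) \<le> norm (1 + (g w)\<^sup>2)" by (simp add: abs_of_nonneg)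
  qed (fact that)
  have C0: "0 \<le> C"
  proof -
    have "0 \<le> expectation (\<lambda>w. (f 0 w)\<^sup>2)" by (rule Bochner_Integration.integral_nonneg) simp
    with bound[of 0] show ?thesis by linarith
  qed
  have J2: "integrable M (\<lambda>w. (J w)\<^sup>2)" "expectation (\<lambda>w. (J w)\<^sup>2) \<le> C"
  proof -
    have "(\<integral>\<^sup>+ w. ennreal ((J w)\<^sup>2) \<partial>M) \<le> (\<integral>\<^sup>+ w. liminf (\<lambda>n. ennreal ((f n w)\<^sup>2)) \<partial>M)"
    proof (rule nn_integral_mono_AE)
      show "AE w in M. ennreal ((J w)\<^sup>2) \<le> liminf (\<lambda>n. ennreal ((f n w)\<^sup>2))"
        using lim
      proof eventually_elim
        case (elim w)
        then have "(\<lambda>n. ennreal ((f n w)\<^sup>2)) \<longlonglongrightarrow> ennreal ((J w)\<^sup>2)"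
          by (intro tendsto_ennrealI tendsto_intros)
        from lim_imp_Liminf[OF trivial_limit_sequentially this] show ?case by simp
      qed
    qed
    also have "\<dots> \<le> liminf (\<lambda>n. \<integral>\<^sup>+ w. ennreal ((f n w)\<^sup>2) \<partial>M)"
      by (intro nn_integral_liminf) auto
    also have "\<dots> \<le> liminf (\<lambda>n. ennreal C)"
      using bound f(2) by (intro Liminf_mono always_eventually allI) (simp add: nn_integral_eq_integral ennreal_leI)
    finally have le: "(\<integral>\<^sup>+ w. ennreal ((J w)\<^sup>2) \<partial>M) \<le> ennreal C"
      by (simp add: Liminf_const)
    then show "integrable M (\<lambda>w. (J w)\<^sup>2)"
      by (intro integrableI_nonneg) (auto simp: top_unique less_top[symmetric])
    with le C0 show "expectation (\<lambda>w. (J w)\<^sup>2) \<le> C"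
      by (simp add: nn_integral_eq_integral)
  qed
  show JI: "integrable M J" by (rule L1[OF J J2(1)])
  have fI: "integrable M (f n)" for n by (rule L1[OF f])
  define g where "g n w = \<bar>f n w - J w\<bar>" for n w
  have g2: "integrable M (\<lambda>w. (g n w)\<^sup>2)" "expectation (\<lambda>w. (g n w)\<^sup>2) \<le> 4 * C" for n
  proof -
    have le: "(g n w)\<^sup>2 \<le> 2 * (f n w)\<^sup>2 + 2 * (J w)\<^sup>2" for w
      unfolding g_def using zero_le_power2[of "f n w + J w"] by (simp add: power2_eq_square algebra_simps)
    have i: "integrable M (\<lambda>w. 2 * (f n w)\<^sup>2 + 2 * (J w)\<^sup>2)" using f(2) J2(1) by simp
    show "integrable M (\<lambda>w. (g n w)\<^sup>2)"
      by (rule Bochner_Integration.integrable_bound[OF i]) (use le in \<open>auto simp: g_def\<close>)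
    then have "expectation (\<lambda>w. (g n w)\<^sup>2) \<le> expectation (\<lambda>w. 2 * (f n w)\<^sup>2 + 2 * (J w)\<^sup>2)"
      by (intro integral_mono i le)
    also have "\<dots> \<le> 4 * C" using bound[of n] J2 f(2) by simp
    finally show "expectation (\<lambda>w. (g n w)\<^sup>2) \<le> 4 * C" .
  qed
  have gI: "integrable M (g n)" for n unfolding g_def using fI JI by simp
  have "(\<lambda>n. expectation (g n)) \<longlonglongrightarrow> 0"
  proof (rule LIMSEQ_I)
    fix e :: real assume e: "0 < e"
    \<comment> \<open>The tail costs at most \<open>4 * C / K\<close>, which is below
      \<open>e / 2\<close> for this \<open>K\<close>; the summand 1 keeps \<open>K\<close> positive
      when \<open>C = 0\<close>.\<close>
    define K where "K = (8 * C + 1) / e"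
    have K: "0 < K" using e C0 by (simp add: K_def)
    have minI: "integrable M (\<lambda>w. min (g n w) K)" for n
      using gI by simp
    have "(\<lambda>n. expectation (\<lambda>w. min (g n w) K)) \<longlonglongrightarrow> expectation (\<lambda>_. 0)"
    proof (rule integral_dominated_convergence[where w="\<lambda>_. K"])
      show "AE w in M. (\<lambda>n. min (g n w) K) \<longlonglongrightarrow> 0"
        using lim
      proof eventually_elim
        case (elim w)
        then have "(\<lambda>n. min \<bar>f n w - J w\<bar> K) \<longlonglongrightarrow> min \<bar>J w - J w\<bar> K"
          by (intro tendsto_intros)
        then show ?case using K by (simp add: g_def)
      qed
    qed (use K in \<open>auto simp: g_def\<close>)
    then have "\<forall>\<^sub>F n in sequentially. expectation (\<lambda>w. min (g n w) K) < e / 2"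
      using e by (intro order_tendstoD) auto
    then obtain n0 where n0: "\<And>n. n0 \<le> n \<Longrightarrow> expectation (\<lambda>w. min (g n w) K) < e / 2"
      unfolding eventually_sequentially by auto
    have "norm (expectation (g n) - 0) < e" if "n0 \<le> n" for n
    proof -
      \<comment> \<open>Up to the level \<open>K\<close> the minimum is \<open>g n w\<close> itself;
        above it \<open>g n w * K \<le> (g n w)\<^sup>2\<close>.\<close>
      have pt: "g n w \<le> min (g n w) K + (g n w)\<^sup>2 / K" for w
      proof (cases "g n w \<le> K")
        case False
        then have "g n w * K \<le> g n w * g n w" using K by (intro mult_left_mono) auto
        then have "g n w \<le> (g n w)\<^sup>2 / K" using K by (simp add: pos_le_divide_eq power2_eq_square)
        then show ?thesis using K False by simp
      qed (use K in simp)
      have "expectation (g n) \<le> expectation (\<lambda>w. min (g n w) K + (g n w)\<^sup>2 / K)"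
        by (intro integral_mono gI Bochner_Integration.integrable_add minI integrable_divide g2 pt)
      also have "\<dots> = expectation (\<lambda>w. min (g n w) K) + expectation (\<lambda>w. (g n w)\<^sup>2) / K"
        using minI[of n] g2(1)[of n] by simp
      also have "\<dots> \<le> expectation (\<lambda>w. min (g n w) K) + 4 * C / K"
        using g2(2)[of n] K by (intro add_left_mono divide_right_mono) auto
      also have "4 * C / K < e / 2"
        using e C0 K by (simp add: K_def field_simps)
      finally have "expectation (g n) < e" using n0[OF that] by simp
      moreover have "0 \<le> expectation (g n)" by (simp add: g_def)
      ultimately show ?thesis by simp
    qed
    then show "\<exists>no. \<forall>n\<ge>no. norm (expectation (g n) - 0) < e" by blast
  qed
  then have "(\<lambda>n. expectation (f n) - expectation J) \<longlonglongrightarrow> 0"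
  proof (rule Lim_null_comparison[rotated], intro always_eventually allI)
    fix n
    have "norm (expectation (\<lambda>w. f n w - J w)) \<le> expectation (g n)"
      unfolding g_def using integral_norm_bound[of M "\<lambda>w. f n w - J w"] by simp
    then show "norm (expectation (f n) - expectation J) \<le> expectation (g n)"
      using fI[of n] JI by simp
  qed
  then show "(\<lambda>n. expectation (f n)) \<longlonglongrightarrow> expectation J"
    by (simp add: LIM_zero_iff)
qed

section \<open>Centred Ito integrals\<close>

locale brownian_filtration = prob_space M
  for M :: "'w measure" and F :: "real \<Rightarrow> 'w measure" and W :: "real \<Rightarrow> 'w \<Rightarrow> real" +
  assumes filtration_F: "filtration (space M) F"
    and sets_F: "sets (F t) \<subseteq> sets M"
    and adapted: "0 \<le> t \<Longrightarrow> W t \<in> borel_measurable (F t)"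
    and normal_increment: "0 \<le> a \<Longrightarrow> a < b \<Longrightarrow> distributed M lborel (\<lambda>w. W b w - W a w)
          (\<lambda>x. ennreal (normal_density 0 (sqrt (b - a)) x))"
    and indep_increment: "0 \<le> a \<Longrightarrow> a < b \<Longrightarrow> indep_set (sets (F a))
          (sets (vimage_algebra (space M) (\<lambda>w. W b w - W a w) borel))"
begin

lemma space_F [simp]: "space (F t) = space M"
  by (rule filtration.space_F[OF filtration_F])

lemma measurable_F_mono: "a \<le> b \<Longrightarrow> X \<in> borel_measurable (F a) \<Longrightarrow> X \<in> borel_measurable (F b)"
  using filtration.sets_F_mono[OF filtration_F, of a b]
  by (auto simp: measurable_def)

lemma measurable_F: "X \<in> borel_measurable (F a) \<Longrightarrow> X \<in> borel_measurable M"
  using sets_F[of a] by (auto simp: measurable_def)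

text \<open>The increment is independent of \<open>F a\<close>, centred and of variance
  \<open>b - a\<close>, so expectations of products with an \<open>F a\<close>-measurable factor
  split.\<close>

lemma
  assumes "0 \<le> a" "a \<le> b" and X: "X \<in> borel_measurable (F a)" "integrable M X"
  shows integrable_mult_increment: "integrable M (\<lambda>w. X w * (W b w - W a w))"
    and expectation_mult_increment: "expectation (\<lambda>w. X w * (W b w - W a w)) = 0"
    and integrable_mult_increment_square: "integrable M (\<lambda>w. X w * (W b w - W a w)\<^sup>2)"
    and expectation_mult_increment_square:
      "expectation (\<lambda>w. X w * (W b w - W a w)\<^sup>2) = expectation X * (b - a)"
proof -
  have "integrable M (\<lambda>w. X w * (W b w - W a w)) \<and> expectation (\<lambda>w. X w * (W b w - W a w)) = 0 \<and>
    integrable M (\<lambda>w. X w * (W b w - W a w)\<^sup>2) \<and>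
    expectation (\<lambda>w. X w * (W b w - W a w)\<^sup>2) = expectation X * (b - a)"
  \<comment> \<open>For equal times the increment is 0; the normal law is available only for
    \<open>a < b\<close>.\<close>
  proof (cases "a = b")
    case False
    with assms have ab: "0 \<le> a" "a < b" by auto
    define D where "D w = W b w - W a w" for w
    note dist = normal_increment[OF ab, folded D_def]
    have D: "D \<in> borel_measurable M" using dist by (simp add: distributed_def)
    have sD: "0 < sqrt (b - a)" using ab by simp
    have D1: "integrable M D" "expectation D = 0"
      using distributed_integrable[OF dist, of "\<lambda>x. x"] distributed_integral[OF dist, of "\<lambda>x. x"]
        integrable_normal_moment_nz_1[OF sD, of 0] integral_normal_moment_nz_1[OF sD, of 0] by simp_all
    have D2: "integrable M (\<lambda>w. (D w)\<^sup>2)" "expectation (\<lambda>w. (D w)\<^sup>2) = b - a"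
      using distributed_integrable[OF dist, of "\<lambda>x. x\<^sup>2"] distributed_integral[OF dist, of "\<lambda>x. x\<^sup>2"]
        integrable_normal_moment[OF sD, of 0 2] integral_normal_moment_even[OF sD, of 0 1] ab by simp_all
    have ind: "indep_var borel X borel (\<lambda>w. f (D w))" if [measurable]: "f \<in> borel_measurable borel" for f :: "real \<Rightarrow> real"
    proof (rule indep_var_of_indep_set[OF indep_increment[OF ab]])
      show "X -` A \<inter> space M \<in> sets (F a)" if "A \<in> sets borel" for A
        using measurable_sets[OF X(1) that] by simp
      show "(\<lambda>w. f (D w)) -` A \<inter> space M \<in> sets (vimage_algebra (space M) (\<lambda>w. W b w - W a w) borel)"
        if "A \<in> sets borel" for A
      proof -
        have "(\<lambda>w. f (D w)) -` A \<inter> space M = D -` (f -` A) \<inter> space M" by auto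
        moreover have "f -` A \<in> sets borel" using measurable_sets[OF \<open>f \<in> _\<close> \<open>A \<in> _\<close>] by simp
        ultimately show ?thesis unfolding D_def by (simp add: in_vimage_algebra)
      qed
      show "(\<lambda>w. f (D w)) \<in> borel_measurable M" using D by measurable
    qed (rule measurable_F[OF X(1)])
    show ?thesis
      using indep_var_integrable[OF ind[of "\<lambda>x. x"] X(2)] indep_var_lebesgue_integral[OF ind[of "\<lambda>x. x"] X(2)]
        indep_var_integrable[OF ind[of "\<lambda>x. x\<^sup>2"] X(2)] indep_var_lebesgue_integral[OF ind[of "\<lambda>x. x\<^sup>2"] X(2)] D1 D2
      unfolding D_def by simp
  qed simp
  then show "integrable M (\<lambda>w. X w * (W b w - W a w))"
    "expectation (\<lambda>w. X w * (W b w - W a w)) = 0"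
    "integrable M (\<lambda>w. X w * (W b w - W a w)\<^sup>2)"
    "expectation (\<lambda>w. X w * (W b w - W a w)\<^sup>2) = expectation X * (b - a)"
    by auto
qed

text \<open>Mean zero and the Ito isometry, by induction on the number of intervals. Each new
  summand is a past-measurable factor times an independent increment, which kills both its mean and
  the cross term of the square. Measurability of the partial sum at time \<open>\<tau> j\<close> is
  carried along to make this factorisation available.\<close>

lemma elementary_integral_moments:
  fixes \<tau> :: "nat \<Rightarrow> real" and \<zeta> :: "nat \<Rightarrow> 'w \<Rightarrow> real"
  assumes t0: "0 \<le> \<tau> 0" and mono: "\<And>i. i < m \<Longrightarrow> \<tau> i \<le> \<tau> (Suc i)"
    and \<zeta>: "\<And>i. i < m \<Longrightarrow> \<zeta> i \<in> borel_measurable (F (\<tau> i))"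
    and bounded: "\<And>i. i < m \<Longrightarrow> \<exists>c. \<forall>w\<in>space M. \<bar>\<zeta> i w\<bar> \<le> c"
  defines "S \<equiv> \<lambda>j w. \<Sum>i<j. \<zeta> i w * (W (\<tau> (Suc i)) w - W (\<tau> i) w)"
  assumes "j \<le> m"
  shows "0 \<le> \<tau> j \<and> S j \<in> borel_measurable (F (\<tau> j)) \<and> integrable M (S j) \<and> expectation (S j) = 0 \<and>
    integrable M (\<lambda>w. (S j w)\<^sup>2) \<and>
    integrable M (\<lambda>w. \<Sum>i<j. (\<zeta> i w)\<^sup>2 * (\<tau> (Suc i) - \<tau> i)) \<and>
    expectation (\<lambda>w. (S j w)\<^sup>2) = expectation (\<lambda>w. \<Sum>i<j. (\<zeta> i w)\<^sup>2 * (\<tau> (Suc i) - \<tau> i))"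
  using \<open>j \<le> m\<close>
proof (induction j)
  case 0
  then show ?case using t0 by (simp add: S_def)
next
  case (Suc j)
  then have j: "j < m" by simp
  from Suc have IH: "0 \<le> \<tau> j" "S j \<in> borel_measurable (F (\<tau> j))" "integrable M (S j)"
    "expectation (S j) = 0" "integrable M (\<lambda>w. (S j w)\<^sup>2)"
    "integrable M (\<lambda>w. \<Sum>i<j. (\<zeta> i w)\<^sup>2 * (\<tau> (Suc i) - \<tau> i))"
    "expectation (\<lambda>w. (S j w)\<^sup>2) = expectation (\<lambda>w. \<Sum>i<j. (\<zeta> i w)\<^sup>2 * (\<tau> (Suc i) - \<tau> i))" by auto
  let ?D = "\<lambda>w. W (\<tau> (Suc j)) w - W (\<tau> j) w"
  have le: "\<tau> j \<le> \<tau> (Suc j)" using mono j by blast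
  have z: "\<zeta> j \<in> borel_measurable (F (\<tau> j))" using \<zeta> j by blast
  obtain c where c: "\<And>w. w \<in> space M \<Longrightarrow> \<bar>\<zeta> j w\<bar> \<le> c" using bounded[OF j] by blast
  have zM: "\<zeta> j \<in> borel_measurable M" by (rule measurable_F[OF z])
  have z1: "integrable M (\<zeta> j)"
    by (rule integrable_const_bound[of _ c]) (use c zM in auto)
  have z2: "integrable M (\<lambda>w. (\<zeta> j w)\<^sup>2)"
    by (rule integrable_const_bound[of _ "c\<^sup>2"])
       (use c zM in \<open>auto intro!: AE_I2 simp: abs_le_square_iff[symmetric] intro: order_trans[OF _ abs_ge_self]\<close>)
  \<comment> \<open>This product is the factor of the cross term; it is integrable because
    \<open>\<zeta> j\<close> is bounded.\<close>
  have zS: "integrable M (\<lambda>w. S j w * \<zeta> j w)"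
  proof (rule Bochner_Integration.integrable_bound)
    show "integrable M (\<lambda>w. c * S j w)" using IH(3) by simp
    show "AE w in M. norm (S j w * \<zeta> j w) \<le> norm (c * S j w)"
    proof (intro AE_I2)
      fix w assume "w \<in> space M"
      from c[OF this] have "\<bar>S j w\<bar> * \<bar>\<zeta> j w\<bar> \<le> \<bar>S j w\<bar> * \<bar>c\<bar>" by (intro mult_left_mono) auto
      then show "norm (S j w * \<zeta> j w) \<le> norm (c * S j w)" by (simp add: abs_mult mult.commute)
    qed
  qed (use measurable_F[OF IH(2)] zM in measurable)
  have Ssuc: "S (Suc j) w = S j w + \<zeta> j w * ?D w" for w by (simp add: S_def)
  note inc = integrable_mult_increment[OF IH(1) le] expectation_mult_increment[OF IH(1) le]
    integrable_mult_increment_square[OF IH(1) le] expectation_mult_increment_square[OF IH(1) le]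
  have sq: "(S (Suc j) w)\<^sup>2 = (S j w)\<^sup>2 + 2 * ((S j w * \<zeta> j w) * ?D w) + (\<zeta> j w)\<^sup>2 * (?D w)\<^sup>2" for w
    unfolding Ssuc by (simp add: power2_eq_square algebra_simps)
  have mSz: "(\<lambda>w. S j w * \<zeta> j w) \<in> borel_measurable (F (\<tau> j))" "(\<lambda>w. (\<zeta> j w)\<^sup>2) \<in> borel_measurable (F (\<tau> j))"
    using IH(2) z by measurable
  have m1: "S (Suc j) \<in> borel_measurable (F (\<tau> (Suc j)))"
  proof -
    have [measurable]: "S j \<in> borel_measurable (F (\<tau> (Suc j)))" "\<zeta> j \<in> borel_measurable (F (\<tau> (Suc j)))"
      "W (\<tau> j) \<in> borel_measurable (F (\<tau> (Suc j)))" "W (\<tau> (Suc j)) \<in> borel_measurable (F (\<tau> (Suc j)))"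
      using measurable_F_mono[OF le] IH(2) z adapted[OF IH(1)] adapted[of "\<tau> (Suc j)"] le IH(1) by auto
    show ?thesis unfolding Ssuc[abs_def] by measurable
  qed
  have i1: "integrable M (S (Suc j))" "expectation (S (Suc j)) = 0"
    using IH(3,4) inc(1,2)[OF z z1] unfolding Ssuc[abs_def] by simp_all
  have i2: "integrable M (\<lambda>w. (S (Suc j) w)\<^sup>2)"
    unfolding sq using IH(5) inc(1)[OF mSz(1) zS] inc(3)[OF mSz(2) z2] by simp
  have e2: "expectation (\<lambda>w. (S (Suc j) w)\<^sup>2) = expectation (\<lambda>w. (S j w)\<^sup>2) + expectation (\<lambda>w. (\<zeta> j w)\<^sup>2) * (\<tau> (Suc j) - \<tau> j)"
    unfolding sq using IH(5) inc[OF mSz(1) zS] inc[OF mSz(2) z2] by simp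
  have "integrable M (\<lambda>w. (\<zeta> j w)\<^sup>2 * (\<tau> (Suc j) - \<tau> j))" using z2 by simp
  then show ?case
    using m1 i1 i2 e2 IH le z2 by simp
qed

end

text \<open>The partial sums increase, so the retained terms form an initial segment whose total
  does not exceed \<open>L\<close>. This is the pathwise effect of stopping.\<close>

lemma sum_truncated_le:
  fixes x :: "nat \<Rightarrow> real"
  assumes "\<And>i. i < m \<Longrightarrow> 0 \<le> x i" "0 \<le> L"
  shows "(\<Sum>i<m. if (\<Sum>j\<le>i. x j) \<le> L then x i else 0) \<le> min L (\<Sum>i<m. x i)"
  using assms
proof (induction m)
  case (Suc m)
  then have "(\<Sum>i<m. if (\<Sum>j\<le>i. x j) \<le> L then x i else 0) \<le> min L (\<Sum>i<m. x i)" "0 \<le> x m" by simp_all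
  moreover have "(\<Sum>j\<le>m. x j) = (\<Sum>i<m. x i) + x m" by (simp add: lessThan_Suc_atMost[symmetric])
  ultimately show ?case by auto
qed simp

text \<open>The intervals are disjoint, so all mixed products vanish. The location of the support is
  part of the claim in order that the induction can see that the last interval is disjoint from the
  earlier ones.\<close>

lemma step_function_square:
  fixes \<tau> z :: "nat \<Rightarrow> real"
  assumes "\<And>i. i < m \<Longrightarrow> \<tau> i \<le> \<tau> (Suc i)"
  shows "(\<Sum>i<m. z i * indicator {\<tau> i<..\<tau> (Suc i)} r)\<^sup>2 = (\<Sum>i<m. (z i)\<^sup>2 * indicator {\<tau> i<..\<tau> (Suc i)} r)
    \<and> ((\<Sum>i<m. (z i)\<^sup>2 * indicator {\<tau> i<..\<tau> (Suc i)} r) \<noteq> 0 \<longrightarrow> \<tau> 0 < r \<and> r \<le> \<tau> m) \<and> \<tau> 0 \<le> \<tau> m"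
  using assms
proof (induction m)
  case (Suc m)
  let ?s = "\<Sum>i<m. z i * indicator {\<tau> i<..\<tau> (Suc i)} r"
  let ?q = "\<Sum>i<m. (z i)\<^sup>2 * indicator {\<tau> i<..\<tau> (Suc i)} r :: real"
  have IH: "?s\<^sup>2 = ?q" "?q \<noteq> 0 \<Longrightarrow> \<tau> 0 < r \<and> r \<le> \<tau> m" "\<tau> 0 \<le> \<tau> m" "\<tau> m \<le> \<tau> (Suc m)"
    using Suc by auto
  show ?case
  proof (cases "r \<in> {\<tau> m<..\<tau> (Suc m)}")
    case True
    then have "?q = 0" using IH(2) by force
    with IH(1) have "?s = 0" by simp
    then show ?thesis using True IH \<open>?q = 0\<close> by auto
  next
    case False
    then show ?thesis using IH by auto
  qed
qed simp

lemma step_function_L2: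
  fixes \<tau> z :: "nat \<Rightarrow> real"
  assumes mono: "\<And>i. i < m \<Longrightarrow> \<tau> i \<le> \<tau> (Suc i)"
  shows "set_integrable lborel {\<tau> 0..\<tau> m} (\<lambda>r. (\<Sum>i<m. z i * indicator {\<tau> i<..\<tau> (Suc i)} r)\<^sup>2)"
    and "(LINT r:{\<tau> 0..\<tau> m}|lborel. (\<Sum>i<m. z i * indicator {\<tau> i<..\<tau> (Suc i)} r)\<^sup>2) =
      (\<Sum>i<m. (z i)\<^sup>2 * (\<tau> (Suc i) - \<tau> i))"
proof -
  have eq: "indicator {\<tau> 0..\<tau> m} r *\<^sub>R (\<Sum>i<m. z i * indicator {\<tau> i<..\<tau> (Suc i)} r)\<^sup>2 =
      (\<Sum>i<m. (z i)\<^sup>2 * indicator {\<tau> i<..\<tau> (Suc i)} r)" for r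
    using step_function_square[where m=m and \<tau>=\<tau> and z=z and r=r, OF mono]
    by (cases "(\<Sum>i<m. (z i)\<^sup>2 * indicator {\<tau> i<..\<tau> (Suc i)} r) = 0") auto
  have i: "integrable lborel (\<lambda>r. (z i)\<^sup>2 * indicator {\<tau> i<..\<tau> (Suc i)} r :: real)" if "i < m" for i
    using mono[OF that] by (intro integrable_mult_right) (simp add: integrable_indicator_iff)
  show "set_integrable lborel {\<tau> 0..\<tau> m} (\<lambda>r. (\<Sum>i<m. z i * indicator {\<tau> i<..\<tau> (Suc i)} r)\<^sup>2)"
    unfolding set_integrable_def eq using i by (intro Bochner_Integration.integrable_sum) auto
  have "(LINT r:{\<tau> 0..\<tau> m}|lborel. (\<Sum>i<m. z i * indicator {\<tau> i<..\<tau> (Suc i)} r)\<^sup>2) =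
      (\<Sum>i<m. LINT r|lborel. (z i)\<^sup>2 * indicator {\<tau> i<..\<tau> (Suc i)} r)"
    unfolding set_lebesgue_integral_def eq using i by (intro Bochner_Integration.integral_sum) auto
  also have "\<dots> = (\<Sum>i<m. (z i)\<^sup>2 * (\<tau> (Suc i) - \<tau> i))"
    using mono by (intro sum.cong) auto
  finally show "(LINT r:{\<tau> 0..\<tau> m}|lborel. (\<Sum>i<m. z i * indicator {\<tau> i<..\<tau> (Suc i)} r)\<^sup>2) =
      (\<Sum>i<m. (z i)\<^sup>2 * (\<tau> (Suc i) - \<tau> i))" .
qed

text \<open>Convergence in probability alone does not carry means to the limit. Stopping keeps the
  approximating integrals centred while bounding their second moments by the expected square
  integral of \<open>X\<close> plus a constant.\<close>

lemma (in brownian_filtration) ito_integral_centred: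
  fixes X :: "real \<Rightarrow> 'w \<Rightarrow> real"
  assumes a: "0 \<le> a"
    and X: "(\<lambda>(w, r). indicator {a..b} r * X r w) \<in> borel_measurable (M \<Otimes>\<^sub>M lborel)"
      "integrable (M \<Otimes>\<^sub>M lborel) (\<lambda>(w, r). indicator {a..b} r * (X r w)\<^sup>2)"
    and ito: "ito_integral M F W X a b J"
  shows "integrable M J" "expectation J = 0"
proof -
  interpret P: pair_sigma_finite M lborel ..
  from ito obtain m0 :: "nat \<Rightarrow> nat" and \<tau>0 :: "nat \<Rightarrow> nat \<Rightarrow> real" and \<zeta>0 :: "nat \<Rightarrow> nat \<Rightarrow> 'w \<Rightarrow> real"
    where J: "J \<in> borel_measurable M"
    and part0: "\<And>n. \<tau>0 n 0 = a" "\<And>n. \<tau>0 n (m0 n) = b"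
      "\<And>n i. i < m0 n \<Longrightarrow> \<tau>0 n i \<le> \<tau>0 n (Suc i)"
      "\<And>n i. i < m0 n \<Longrightarrow> \<zeta>0 n i \<in> borel_measurable (F (\<tau>0 n i))"
      "\<And>n i. i < m0 n \<Longrightarrow> \<exists>c. \<forall>w\<in>space M. \<bar>\<zeta>0 n i w\<bar> \<le> c"
    and cD: "conv_in_prob M (\<lambda>n w. (LINT r:{a..b}|lborel.
             (X r w - (\<Sum>i<m0 n. \<zeta>0 n i w * indicator {\<tau>0 n i<..\<tau>0 n (Suc i)} r))\<^sup>2)) (\<lambda>_. 0)"
    and cS: "conv_in_prob M (\<lambda>n w. \<Sum>i<m0 n. \<zeta>0 n i w * (W (\<tau>0 n (Suc i)) w - W (\<tau>0 n i) w)) J"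
    unfolding ito_integral_def by (elim conjE exE) blast
  define K0 where "K0 n r w = (\<Sum>i<m0 n. \<zeta>0 n i w * indicator {\<tau>0 n i<..\<tau>0 n (Suc i)} r)" for n r w
  have nonneg0: "0 \<le> \<tau>0 n i" if "i \<le> m0 n" for n i
    using that
  proof (induction i)
    case (Suc i)
    then show ?case using part0(3)[of i n] by simp
  qed (use a part0(1) in simp)
  have \<zeta>0_meas: "\<zeta>0 n i \<in> borel_measurable M" if "i < m0 n" for n i
    by (rule measurable_F[OF part0(4)[OF that]])
  have W_meas: "W u \<in> borel_measurable M" if "0 \<le> u" for u
    by (rule measurable_F[OF adapted[OF that]])
  have D_meas: "(\<lambda>w. LINT r:{a..b}|lborel. (X r w - K0 n r w)\<^sup>2) \<in> borel_measurable M" for n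
  proof -
    have K: "(\<lambda>z. K0 n (snd z) (fst z)) \<in> borel_measurable (M \<Otimes>\<^sub>M lborel)"
      unfolding K0_def
      by (intro borel_measurable_sum borel_measurable_times measurable_compose[OF measurable_fst]
          measurable_compose[OF measurable_snd] \<zeta>0_meas) auto
    \<comment> \<open>Joint measurability of \<open>X\<close> is known only on the interval, hence
      the indicator is moved inside the square.\<close>
    have "(\<lambda>z. indicator {a..b} (snd z) *\<^sub>R (X (snd z) (fst z) - K0 n (snd z) (fst z))\<^sup>2) =
        (\<lambda>z. (indicator {a..b} (snd z) * X (snd z) (fst z) - indicator {a..b} (snd z) * K0 n (snd z) (fst z))\<^sup>2)"
      by (auto simp: indicator_def)
    also have "\<dots> \<in> borel_measurable (M \<Otimes>\<^sub>M lborel)"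
      using X(1) K unfolding split_beta' by measurable
    finally show ?thesis
      unfolding set_lebesgue_integral_def
      by (intro lborel.borel_measurable_lebesgue_integral) (simp add: split_beta')
  qed
  have S_meas: "(\<lambda>w. \<Sum>i<m0 n. \<zeta>0 n i w * (W (\<tau>0 n (Suc i)) w - W (\<tau>0 n i) w)) \<in> borel_measurable M" for n
    by (intro borel_measurable_sum borel_measurable_times borel_measurable_diff \<zeta>0_meas W_meas nonneg0) auto
  from conv_in_prob_subseq[OF S_meas J cS D_meas borel_measurable_const cD[folded K0_def]]
  obtain r where
    r1: "\<And>n. prob {w \<in> space M. (1/2)^n < \<bar>(LINT u:{a..b}|lborel. (X u w - K0 (r n) u w)\<^sup>2) - 0\<bar>} \<le> (1/2)^n"
    and r2: "AE w in M. (\<lambda>n. \<Sum>i<m0 (r n). \<zeta>0 (r n) i w * (W (\<tau>0 (r n) (Suc i)) w - W (\<tau>0 (r n) i) w)) \<longlonglongrightarrow> J w"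
    and r3: "AE w in M. \<forall>\<^sub>F n in sequentially. \<bar>(LINT u:{a..b}|lborel. (X u w - K0 (r n) u w)\<^sup>2) - 0\<bar> \<le> (1/2)^n"
    by blast
  define m where "m n = m0 (r n)" for n
  define \<tau> where "\<tau> n = \<tau>0 (r n)" for n
  define \<zeta> where "\<zeta> n = \<zeta>0 (r n)" for n
  define D where "D n w = (LINT u:{a..b}|lborel. (X u w - K0 (r n) u w)\<^sup>2)" for n w
  define dt where "dt n i = \<tau> n (Suc i) - \<tau> n i" for n i
  define Qn where "Qn n w = (\<Sum>i<m n. (\<zeta> n i w)\<^sup>2 * dt n i)" for n w
  define Q where "Q w = (LINT u:{a..b}|lborel. (X u w)\<^sup>2)" for w
  \<comment> \<open>The test for interval \<open>i\<close> involves the integrand only up to index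
    \<open>i\<close>, all of which is known at the left end point, so the stopped integrand
    \<open>z\<close> remains predictable. The level \<open>n\<close> grows so that eventually
    nothing is stopped on a given path.\<close>
  define ok where "ok n i w \<longleftrightarrow> (\<Sum>j\<le>i. (\<zeta> n j w)\<^sup>2 * dt n j) \<le> real n" for n i w
  define z where "z n i w = (if ok n i w then \<zeta> n i w else 0)" for n i w
  define f where "f n w = (\<Sum>i<m n. z n i w * (W (\<tau> n (Suc i)) w - W (\<tau> n i) w))" for n w
  note defs = m_def \<tau>_def \<zeta>_def
  have part: "\<tau> n 0 = a" "\<tau> n (m n) = b"
      "i < m n \<Longrightarrow> \<tau> n i \<le> \<tau> n (Suc i)"
      "i < m n \<Longrightarrow> \<zeta> n i \<in> borel_measurable (F (\<tau> n i))"
      "i < m n \<Longrightarrow> \<exists>c. \<forall>w\<in>space M. \<bar>\<zeta> n i w\<bar> \<le> c" for n i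
    using part0 unfolding defs by blast+
  have mono: "\<tau> n j \<le> \<tau> n i" if "j \<le> i" "i \<le> m n" for n i j
    using that
  proof (induction i rule: dec_induct)
    case (step i)
    then show ?case using part(3)[of i n] by simp
  qed simp
  have dt: "i < m n \<Longrightarrow> 0 \<le> dt n i" for n i using part(3)[of i n] by (simp add: dt_def)
  have D0: "0 \<le> D n w" for n w
    unfolding D_def set_lebesgue_integral_def by (intro Bochner_Integration.integral_nonneg) simp
  have Q0: "0 \<le> Q w" for w
    unfolding Q_def set_lebesgue_integral_def by (intro Bochner_Integration.integral_nonneg) simp
  have [measurable]: "D n \<in> borel_measurable M" for n
    unfolding D_def by (rule D_meas)
  have QI: "integrable M Q"
    using P.integrable_fst'[OF X(2)] unfolding Q_def set_lebesgue_integral_def by simp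
  have X2: "AE w in M. set_integrable lborel {a..b} (\<lambda>u. (X u w)\<^sup>2)"
    using P.AE_integrable_fst'[OF X(2)] unfolding set_integrable_def by simp
  \<comment> \<open>The exceptional null set consists of the paths of \<open>X\<close> that are not
    square integrable, so it is the same for all \<open>n\<close>.\<close>
  have Qn_le: "AE w in M. \<forall>n. Qn n w \<le> 2 * Q w + 2 * D n w"
    using X2 AE_space
  proof eventually_elim
    case (elim w)
    show ?case
    proof
      fix n
      have K: "K0 (r n) u w = (\<Sum>i<m n. \<zeta> n i w * indicator {\<tau> n i<..\<tau> n (Suc i)} u)" for u
        by (simp add: K0_def defs)
      have K2: "set_integrable lborel {a..b} (\<lambda>u. (K0 (r n) u w)\<^sup>2)"
        and KQ: "(LINT u:{a..b}|lborel. (K0 (r n) u w)\<^sup>2) = Qn n w"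
        unfolding K Qn_def dt_def
        using step_function_L2[of "m n" "\<tau> n" "\<lambda>i. \<zeta> n i w", OF part(3)] part(1,2)[of n] by simp_all
      \<comment> \<open>Integrability excludes the default value 0 of the integral, so that
        \<open>D n w\<close> is the genuine squared distance.\<close>
      have XK: "set_integrable lborel {a..b} (\<lambda>u. (X u w - K0 (r n) u w)\<^sup>2)"
        unfolding set_integrable_def
      proof (rule Bochner_Integration.integrable_bound)
        show "integrable lborel (\<lambda>u. indicator {a..b} u *\<^sub>R (2 * (X u w)\<^sup>2 + 2 * (K0 (r n) u w)\<^sup>2))"
          using elim(1) K2 unfolding set_integrable_def[symmetric]
          by (intro set_integral_add(1)) simp_all
        have "(x - y)\<^sup>2 \<le> 2 * x\<^sup>2 + 2 * y\<^sup>2" for x y :: real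
          using zero_le_power2[of "x + y"] by (simp add: power2_eq_square algebra_simps)
        then show "AE u in lborel. norm (indicator {a..b} u *\<^sub>R (X u w - K0 (r n) u w)\<^sup>2)
            \<le> norm (indicator {a..b} u *\<^sub>R (2 * (X u w)\<^sup>2 + 2 * (K0 (r n) u w)\<^sup>2))"
          by (intro AE_I2) (auto simp: indicator_def)
        have [measurable]: "(\<lambda>u. indicator {a..b} u * X u w) \<in> borel_measurable lborel"
          using measurable_Pair2[OF X(1) elim(2)] by simp
        have [measurable]: "(\<lambda>u. K0 (r n) u w) \<in> borel_measurable lborel"
          unfolding K by measurable
        have "(\<lambda>u. indicator {a..b} u *\<^sub>R (X u w - K0 (r n) u w)\<^sup>2) =
            (\<lambda>u. (indicator {a..b} u * X u w - indicator {a..b} u * K0 (r n) u w)\<^sup>2)"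
          by (auto simp: indicator_def)
        also have "\<dots> \<in> borel_measurable lborel" by measurable
        finally show "(\<lambda>u. indicator {a..b} u *\<^sub>R (X u w - K0 (r n) u w)\<^sup>2) \<in> borel_measurable lborel" .
      qed
      have "Qn n w \<le> (LINT u:{a..b}|lborel. 2 * (X u w)\<^sup>2 + 2 * (X u w - K0 (r n) u w)\<^sup>2)"
        unfolding KQ[symmetric]
      proof (rule set_integral_mono[OF K2])
        show "set_integrable lborel {a..b} (\<lambda>u. 2 * (X u w)\<^sup>2 + 2 * (X u w - K0 (r n) u w)\<^sup>2)"
          using elim(1) XK by (intro set_integral_add) simp_all
        have "y\<^sup>2 \<le> 2 * x\<^sup>2 + 2 * (x - y)\<^sup>2" for x y :: real
          using zero_le_power2[of "2 * x - y"] by (simp add: power2_eq_square algebra_simps)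
        then show "(K0 (r n) u w)\<^sup>2 \<le> 2 * (X u w)\<^sup>2 + 2 * (X u w - K0 (r n) u w)\<^sup>2" for u by simp
      qed
      also have "\<dots> = 2 * Q w + 2 * D n w"
        unfolding Q_def D_def using elim(1) XK by (subst set_integral_add) simp_all
      finally show "Qn n w \<le> 2 * Q w + 2 * D n w" .
    qed
  qed
  have z_meas: "z n i \<in> borel_measurable (F (\<tau> n i))" if i: "i < m n" for n i
  proof -
    have "\<zeta> n j \<in> borel_measurable (F (\<tau> n i))" if "j \<le> i" for j
      using measurable_F_mono[OF mono part(4)] that i by simp
    then have "(\<lambda>w. \<Sum>j\<le>i. (\<zeta> n j w)\<^sup>2 * dt n j) \<in> borel_measurable (F (\<tau> n i))"
      by (intro borel_measurable_sum) auto
    then have [measurable]: "Measurable.pred (F (\<tau> n i)) (ok n i)"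
      unfolding ok_def by measurable
    show ?thesis
      unfolding z_def using part(4)[OF i] by measurable
  qed
  have z_bd: "\<exists>c. \<forall>w\<in>space M. \<bar>z n i w\<bar> \<le> c" if i: "i < m n" for n i
  proof -
    obtain c where c: "\<forall>w\<in>space M. \<bar>\<zeta> n i w\<bar> \<le> c" using part(5)[OF i] by blast
    have "\<forall>w\<in>space M. \<bar>z n i w\<bar> \<le> max 0 c" using c by (auto simp: z_def le_max_iff_disj)
    then show ?thesis by blast
  qed
  have moments: "integrable M (f n)" "expectation (f n) = 0" "integrable M (\<lambda>w. (f n w)\<^sup>2)"
    "integrable M (\<lambda>w. \<Sum>i<m n. (z n i w)\<^sup>2 * dt n i)"
    "expectation (\<lambda>w. (f n w)\<^sup>2) = expectation (\<lambda>w. \<Sum>i<m n. (z n i w)\<^sup>2 * dt n i)" for n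
    using elementary_integral_moments[of "\<tau> n" "m n" "z n" "m n"] part(1,3) z_meas z_bd a
    unfolding f_def[abs_def] dt_def by auto
  have zsum: "(\<Sum>i<m n. (z n i w)\<^sup>2 * dt n i) \<le> min (real n) (Qn n w)" for n w
  proof -
    have "(\<Sum>i<m n. (z n i w)\<^sup>2 * dt n i) =
        (\<Sum>i<m n. if (\<Sum>j\<le>i. (\<zeta> n j w)\<^sup>2 * dt n j) \<le> real n then (\<zeta> n i w)\<^sup>2 * dt n i else 0)"
      by (intro sum.cong) (auto simp: z_def ok_def)
    also have "\<dots> \<le> min (real n) (Qn n w)"
      unfolding Qn_def using dt by (intro sum_truncated_le) auto
    finally show ?thesis .
  qed
  \<comment> \<open>Off the set \<open>?B\<close> the error is at most 1, and on it the minimum is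
    at most \<open>n\<close> while the probability is at most \<open>(1/2)^n\<close>. So the
    expected minimum is at most \<open>1 + n / 2^n \<le> 2\<close>, which enters twice and yields
    the constant 4.\<close>
  have bound: "expectation (\<lambda>w. (f n w)\<^sup>2) \<le> 2 * expectation Q + 4" for n
  proof -
    let ?B = "{w \<in> space M. (1/2)^n < \<bar>D n w\<bar>}"
    have minI: "integrable M (\<lambda>w. min (real n) (D n w))"
      by (rule integrable_const_bound[of _ "real n"]) (use D0 in \<open>auto intro!: AE_I2\<close>)
    have iB: "integrable M (indicator ?B :: 'w \<Rightarrow> real)"
      by (intro integrable_real_indicator) (auto simp: emeasure_eq_measure)
    then have BI: "integrable M (\<lambda>w. 1 + real n * indicator ?B w)" by simp
    have "expectation (\<lambda>w. min (real n) (D n w)) \<le> expectation (\<lambda>w. 1 + real n * indicator ?B w)"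
    proof (rule integral_mono[OF minI BI])
      fix w assume w: "w \<in> space M"
      show "min (real n) (D n w) \<le> 1 + real n * indicator ?B w"
      proof (cases "w \<in> ?B")
        case False
        then have "D n w \<le> (1/2)^n" using w by auto
        also have "\<dots> \<le> 1" by (intro power_le_one) auto
        finally show ?thesis using False by (simp add: min_le_iff_disj)
      qed simp
    qed
    also have "\<dots> = 1 + real n * prob ?B"
      using iB by (simp add: prob_space)
    also have "\<dots> \<le> 1 + real n * (1/2)^n"
      using r1[of n] by (intro add_left_mono mult_left_mono) (auto simp: D_def)
    also have "\<dots> \<le> 2"
    proof -
      have "real n < 2 ^ n" by (rule of_nat_less_two_power)
      then show ?thesis by (simp add: power_divide)
    qed
    finally have min2: "expectation (\<lambda>w. min (real n) (D n w)) \<le> 2" .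
    have "expectation (\<lambda>w. (f n w)\<^sup>2) \<le> expectation (\<lambda>w. 2 * Q w + 2 * min (real n) (D n w))"
      unfolding moments(5)
    proof (rule integral_mono_AE[OF moments(4)])
      show "AE w in M. (\<Sum>i<m n. (z n i w)\<^sup>2 * dt n i) \<le> 2 * Q w + 2 * min (real n) (D n w)"
        using Qn_le
      proof eventually_elim
        case (elim w)
        then have "Qn n w \<le> 2 * Q w + 2 * D n w" by blast
        with zsum[of n w] Q0[of w] D0[of n w] show ?case by (auto simp: min_def split: if_splits)
      qed
    qed (use QI minI in simp)
    also have "\<dots> \<le> 2 * expectation Q + 4" using QI minI min2 by simp
    finally show ?thesis .
  qed
  have lim: "AE w in M. (\<lambda>n. f n w) \<longlonglongrightarrow> J w"
    using r2 r3 Qn_le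
  proof eventually_elim
    case (elim w)
    \<comment> \<open>Once the error is at most 1 and \<open>n\<close> exceeds
      \<open>2 * Q w + 2\<close>, the accumulated square stays below \<open>n\<close>, and the
      stopped integral agrees with the original one.\<close>
    have "\<forall>\<^sub>F n in sequentially. 2 * Q w + 2 \<le> real n"
      using filterlim_real_sequentially by (simp add: filterlim_at_top)
    then have "\<forall>\<^sub>F n in sequentially. (\<Sum>i<m n. \<zeta> n i w * (W (\<tau> n (Suc i)) w - W (\<tau> n i) w)) = f n w"
      using elim(2)
    proof eventually_elim
      case (elim n)
      have "D n w \<le> (1/2)^n" using elim(2) D0[of n w] by (simp add: D_def)
      also have "\<dots> \<le> 1" by (intro power_le_one) auto
      finally have "Qn n w \<le> 2 * Q w + 2"
        using \<open>\<forall>n. Qn n w \<le> 2 * Q w + 2 * D n w\<close>[rule_format, of n] by simp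
      with elim(1) have le: "Qn n w \<le> real n" by simp
      have "ok n i w" if i: "i < m n" for i
      proof -
        have "(\<Sum>j\<le>i. (\<zeta> n j w)\<^sup>2 * dt n j) \<le> Qn n w"
          unfolding Qn_def using i dt by (intro sum_mono2) auto
        with le show ?thesis by (simp add: ok_def)
      qed
      then show ?case unfolding f_def by (intro sum.cong) (auto simp: z_def)
    qed
    then show ?case
      by (rule Lim_transform_eventually[OF elim(1)[folded defs]])
  qed
  have fm: "f n \<in> borel_measurable M" for n using moments(1) by simp
  show "integrable M J"
    by (rule integral_tendsto_of_bounded_second_moment(1)[OF fm moments(3) bound J lim])
  have "(\<lambda>n. expectation (f n)) \<longlonglongrightarrow> expectation J"
    by (rule integral_tendsto_of_bounded_second_moment(2)[OF fm moments(3) bound J lim])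
  then show "expectation J = 0"
    by (simp add: moments(2) LIMSEQ_const_iff)
qed

section \<open>The mean of the variance\<close>

text \<open>The indefinite integral \<open>I\<close> of \<open>\<mu>\<close> and the closed form
  \<open>P\<close> solve the same linear differential equation and both start at 0; the integrating
  factor \<open>exp (\<theta> * u)\<close> makes their difference constant.\<close>

lemma linear_integral_equation:
  fixes \<mu> :: "real \<Rightarrow> real"
  assumes \<theta>: "0 < \<theta>" and t: "t \<le> T" and int: "set_integrable lborel {t..T} \<mu>"
    and eq: "\<And>u. u \<in> {t..T} \<Longrightarrow> \<mu> u = v + \<theta> * \<alpha> * (u - t) - \<theta> * (LINT r:{t..u}|lborel. \<mu> r)"
  shows "(LINT r:{t..T}|lborel. \<mu> r) = (v - \<alpha>) / \<theta> * (1 - exp (- \<theta> * (T - t))) + \<alpha> * (T - t)"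
proof -
  define I where "I u = integral {t..u} \<mu>" for u
  define P where "P u = (v - \<alpha>) / \<theta> * (1 - exp (- \<theta> * (u - t))) + \<alpha> * (u - t)" for u
  have I: "(LINT r:{t..u}|lborel. \<mu> r) = I u" if "u \<in> {t..T}" for u
    unfolding I_def using set_borel_integral_eq_integral(2)[OF set_integrable_subset[OF int]] that by auto
  have cI: "continuous_on {t..T} I"
    unfolding I_def by (rule indefinite_integral_continuous_1[OF set_borel_integral_eq_integral(1)[OF int]])
  have eqI: "\<mu> u = v + \<theta> * \<alpha> * (u - t) - \<theta> * I u" if "u \<in> {t..T}" for u
    using eq[OF that] I[OF that] by simp
  have "continuous_on {t..T} \<mu>"
    by (subst continuous_on_cong[OF refl eqI]) (auto intro!: continuous_intros cI)
  then have dI: "(I has_real_derivative \<mu> u) (at u within {t..T})" if "u \<in> {t..T}" for u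
    unfolding I_def using that by (rule integral_has_real_derivative)
  have dP: "(P has_real_derivative (v - \<alpha>) * exp (- \<theta> * (u - t)) + \<alpha>) (at u within {t..T})" for u
    unfolding P_def using \<theta> by (auto intro!: derivative_eq_intros simp: field_simps)
  have "((\<lambda>u. (I u - P u) * exp (\<theta> * u)) has_real_derivative 0) (at u within {t..T})" if u: "u \<in> {t..T}" for u
  proof -
    have "((\<lambda>u. (I u - P u) * exp (\<theta> * u)) has_real_derivative
        (\<mu> u - ((v - \<alpha>) * exp (- \<theta> * (u - t)) + \<alpha>)) * exp (\<theta> * u) + \<theta> * exp (\<theta> * u) * (I u - P u))
        (at u within {t..T})"
      by (auto intro!: derivative_eq_intros dI[OF u] dP)
    moreover have "\<mu> u - ((v - \<alpha>) * exp (- \<theta> * (u - t)) + \<alpha>) = - \<theta> * (I u - P u)"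
      unfolding eqI[OF u] P_def using \<theta> by (simp add: field_simps)
    ultimately show ?thesis by (simp only:) (simp add: algebra_simps)
  qed
  from has_field_derivative_zero_constant[OF _ this] obtain c
    where c: "\<And>u. u \<in> {t..T} \<Longrightarrow> (I u - P u) * exp (\<theta> * u) = c" by auto
  have "c = 0" using c[of t] t by (simp add: I_def P_def)
  then have "I T = P T" using c[of T] t by simp
  then show ?thesis using I[of T] t by (simp add: P_def)
qed

section \<open>The market as a Brownian filtration, and the mean of its variance\<close>

lemma (in prob_space) indep_set_of_indep_sets:
  assumes ind: "indep_sets G I" and ij: "i \<in> I" "j \<in> I" "i \<noteq> j"
  shows "indep_set (G i) (G j)"
proof (rule indep_setI)
  show "G i \<subseteq> events" "G j \<subseteq> events" using ind ij by (auto simp: indep_sets_def)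
  fix a b assume "a \<in> G i" "b \<in> G j"
  then show "prob (a \<inter> b) = prob a * prob b"
    using indep_setsD[OF ind, of "{i, j}" "\<lambda>k. if k = i then a else b"] ij
    by (auto simp: Int_commute)
qed

locale heston_market =
  fixes m :: "('w, 'z) model_scheme"
  assumes market: "market_model m"
begin

sublocale prob_space "prb m"
  using market by (simp add: market_model_def)

sublocale P: pair_sigma_finite "prb m" lborel ..

lemma parameters: "0 < theta m" "0 < horizon m"
  using market by (auto simp: market_model_def)

text \<open>The Brownian motion \<open>bm m\<close> is chosen because it drives the variance, whose
  Ito integral has to be centred.\<close>

sublocale brownian_filtration "prb m" "filt m" "bm m"
proof (intro brownian_filtration.intro brownian_filtration_axioms.intro)
  show "prob_space (prb m)" by (rule prob_space_axioms)
  note mm = market[unfolded market_model_def brownian_pair_def]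
  show "filtration (space (prb m)) (filt m)" "\<And>t. sets (filt m t) \<subseteq> sets (prb m)"
    using mm by auto
  show "\<And>t. 0 \<le> t \<Longrightarrow> bm m t \<in> borel_measurable (filt m t)"
    "\<And>a b. 0 \<le> a \<Longrightarrow> a < b \<Longrightarrow> distributed (prb m) lborel (\<lambda>w. bm m b w - bm m a w)
          (\<lambda>x. ennreal (normal_density 0 (sqrt (b - a)) x))"
    using mm by auto
  fix a b :: real assume ab: "0 \<le> a" "a < b"
  let ?L = "[sets (filt m a), sets (vimage_algebra (space (prb m)) (\<lambda>w. bm m b w - bm m a w) borel),
                sets (vimage_algebra (space (prb m)) (\<lambda>w. bm' m b w - bm' m a w) borel)]"
  have "indep_sets (\<lambda>j. ?L ! j) {..<3}" using mm ab by blast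
  from indep_set_of_indep_sets[OF this, of 0 1]
  show "indep_set (sets (filt m a)) (sets (vimage_algebra (space (prb m)) (\<lambda>w. bm m b w - bm m a w) borel))"
    by simp
qed

text \<open>The state processes are controlled only between \<open>t\<close> and the horizon;
  clipped time extends them constantly to the whole line.\<close>

abbreviation "clip t u \<equiv> min (max t u) (horizon m)"

text \<open>Measurability relative to \<open>filt m (horizon m)\<close>, rather than only
  \<open>prb m\<close>, is what later allows independence from the order clocks to be
  applied.\<close>

lemma adapted_continuous_jointly_measurable:
  assumes t: "t \<le> horizon m"
    and meas: "\<And>u. u \<in> {t..horizon m} \<Longrightarrow> Y u \<in> borel_measurable (filt m u)"
    and cont: "\<And>w. w \<in> space (prb m) \<Longrightarrow> continuous_on {t..horizon m} (\<lambda>u. Y u w)"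
  shows "(\<lambda>(w, u). Y (clip t u) w :: real) \<in> borel_measurable (filt m (horizon m) \<Otimes>\<^sub>M borel)"
proof (rule borel_measurable_right_continuous_paths[where Y="\<lambda>u. Y (min u (horizon m))"])
  show "Y (min u (horizon m)) \<in> borel_measurable (filt m (horizon m))" if "t \<le> u" for u
    using t that by (intro measurable_F_mono[OF _ meas]) auto
  fix w u assume w: "w \<in> space (filt m (horizon m))" and u: "t \<le> u"
  have "continuous_on {t..} (\<lambda>r. Y (min r (horizon m)) w)"
    using t w by (intro continuous_on_compose2[OF cont[of w]] continuous_intros) auto
  then have "continuous (at u within {t..}) (\<lambda>r. Y (min r (horizon m)) w)"
    using u by (simp add: continuous_on_eq_continuous_within)
  then show "continuous (at_right u) (\<lambda>r. Y (min r (horizon m)) w)"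
    by (rule continuous_within_subset) (use u in auto)
qed

context
  fixes t s v :: real
  assumes state: "0 \<le> t" "t \<le> horizon m" "0 \<le> v"
begin

lemma paths:
  "u \<in> {t..horizon m} \<Longrightarrow> vol m t v u \<in> borel_measurable (filt m u)"
  "u \<in> {t..horizon m} \<Longrightarrow> stock m t s v u \<in> borel_measurable (filt m u)"
  "w \<in> space (prb m) \<Longrightarrow> continuous_on {t..horizon m} (\<lambda>u. vol m t v u w)"
  "w \<in> space (prb m) \<Longrightarrow> continuous_on {t..horizon m} (\<lambda>u. stock m t s v u w)"
  "w \<in> space (prb m) \<Longrightarrow> u \<in> {t..horizon m} \<Longrightarrow> 0 \<le> vol m t v u w"
  using market state unfolding market_model_def heston_dynamics_def by blast+

lemma vol_dynamics:
  assumes "u \<in> {t..horizon m}"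
  shows "\<exists>J. ito_integral (prb m) (filt m) (bm m) (\<lambda>r w. sqrt (vol m t v r w)) t u J \<and>
              (AE w in prb m. vol m t v u w =
                 v + (LINT r:{t..u}|lborel. theta m * (alpha m - vol m t v r w)) + xi m * J w)"
  using market state assms unfolding market_model_def heston_dynamics_def by blast

lemma vol_measurable:
  "(\<lambda>(w, u). vol m t v (clip t u) w) \<in> borel_measurable (filt m (horizon m) \<Otimes>\<^sub>M borel)"
  by (rule adapted_continuous_jointly_measurable[OF state(2) paths(1,3)])

lemma stock_measurable:
  "(\<lambda>(w, u). stock m t s v (clip t u) w) \<in> borel_measurable (filt m (horizon m) \<Otimes>\<^sub>M borel)"
  by (rule adapted_continuous_jointly_measurable[OF state(2) paths(2,4)])

text \<open>Taking expectations in the variance equation removes the centred Ito term, and Fubini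
  turns the drift into an integral of the mean, which therefore satisfies
  \<open>linear_integral_equation\<close>.\<close>

lemma running_variance:
  assumes fin: "finite_running m (\<lambda>s v t. v)"
  shows "running m (\<lambda>s v t. v) s v t =
    (v - alpha m) / theta m * (1 - exp (- theta m * (horizon m - t))) + alpha m * (horizon m - t)"
proof -
  define \<mu> where "\<mu> u = expectation (vol m t v u)" for u
  have int: "integrable (prb m \<Otimes>\<^sub>M lborel) (\<lambda>(w, r). indicator {t..u} r * vol m t v r w)"
    if u: "u \<in> {t..horizon m}" for u
  proof -
    have "integrable (prb m \<Otimes>\<^sub>M lborel) (\<lambda>(w, r). indicator {t..horizon m} r * vol m t v r w)"
      using fin state unfolding finite_running_def by blast
    then have "integrable (prb m \<Otimes>\<^sub>M lborel)
        (\<lambda>z. indicator (space (prb m) \<times> {t..u}) z *\<^sub>R (case z of (w, r) \<Rightarrow> indicator {t..horizon m} r * vol m t v r w))"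
      by (rule integrable_mult_indicator[rotated]) simp
    then show ?thesis
      by (rule Bochner_Integration.integrable_cong[THEN iffD1, rotated 2])
         (use u in \<open>auto simp: indicator_def space_pair_measure\<close>)
  qed
  have inner: "(LINT r|lborel. indicator {t..u} r * vol m t v r w) = (LINT r:{t..u}|lborel. vol m t v r w)" for u w
    by (simp add: set_lebesgue_integral_def)
  have fub: "expectation (\<lambda>w. LINT r:{t..u}|lborel. vol m t v r w) = (LINT r:{t..u}|lborel. \<mu> r)"
    if u: "u \<in> {t..horizon m}" for u
    using P.Fubini_integral[OF int[OF u]] by (simp add: set_lebesgue_integral_def \<mu>_def)
  have \<mu>_int: "set_integrable lborel {t..horizon m} \<mu>"
    using P.integrable_snd[OF int[of "horizon m"]] state
    by (simp add: set_integrable_def \<mu>_def[abs_def])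
  have eq: "\<mu> u = v + theta m * alpha m * (u - t) - theta m * (LINT r:{t..u}|lborel. \<mu> r)"
    if u: "u \<in> {t..horizon m}" for u
  proof -
    obtain J where ito: "ito_integral (prb m) (filt m) (bm m) (\<lambda>r w. sqrt (vol m t v r w)) t u J"
      and J: "AE w in prb m. vol m t v u w =
                 v + (LINT r:{t..u}|lborel. theta m * (alpha m - vol m t v r w)) + xi m * J w"
      using vol_dynamics[OF u] by blast
    \<comment> \<open>The square root commutes with the indicator, so measurability is inherited
      from the integrable variance on the strip.\<close>
    have mX: "(\<lambda>(w, r). indicator {t..u} r * sqrt (vol m t v r w)) \<in> borel_measurable (prb m \<Otimes>\<^sub>M lborel)"
    proof -
      have [measurable]: "(\<lambda>(w, r). indicator {t..u} r * vol m t v r w) \<in> borel_measurable (prb m \<Otimes>\<^sub>M lborel)"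
        using int[OF u] by simp
      have "(\<lambda>(w, r). indicator {t..u} r * sqrt (vol m t v r w)) =
          (\<lambda>z. sqrt (case z of (w, r) \<Rightarrow> indicator {t..u} r * vol m t v r w))"
        by (auto simp: indicator_def)
      also have "\<dots> \<in> borel_measurable (prb m \<Otimes>\<^sub>M lborel)" by measurable
      finally show ?thesis .
    qed
    \<comment> \<open>Since the variance is nonnegative, the square integrability of the Ito
      integrand is exactly finiteness of the expected integrated variance.\<close>
    have iX: "integrable (prb m \<Otimes>\<^sub>M lborel) (\<lambda>(w, r). indicator {t..u} r * (sqrt (vol m t v r w))\<^sup>2)"
      using int[OF u]
      by (rule Bochner_Integration.integrable_cong[THEN iffD1, rotated 2])
         (use u paths(5) in \<open>auto simp: indicator_def space_pair_measure\<close>)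
    have J0: "integrable (prb m) J" "expectation J = 0"
      using ito_integral_centred[OF state(1) mX iX ito] by auto
    have I: "integrable (prb m) (\<lambda>w. LINT r:{t..u}|lborel. vol m t v r w)"
      using P.integrable_fst'[OF int[OF u]] by (simp add: inner)
    \<comment> \<open>Continuous paths are integrable on the compact interval, so the drift splits
      on every path.\<close>
    have drift: "(LINT r:{t..u}|lborel. theta m * (alpha m - vol m t v r w)) =
        theta m * alpha m * (u - t) - theta m * (LINT r:{t..u}|lborel. vol m t v r w)"
      if w: "w \<in> space (prb m)" for w
    proof -
      have "set_integrable lborel {t..u} (\<lambda>r. vol m t v r w)"
        using u by (intro borel_integrable_atLeastAtMost' continuous_on_subset[OF paths(3)[OF w]]) auto
      moreover have "set_integrable lborel {t..u} (\<lambda>r. alpha m)"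
        by (intro borel_integrable_atLeastAtMost' continuous_intros)
      ultimately have "(LINT r:{t..u}|lborel. alpha m - vol m t v r w) =
          (LINT r:{t..u}|lborel. alpha m) - (LINT r:{t..u}|lborel. vol m t v r w)"
        by (intro set_integral_diff(2))
      moreover have "(LINT r:{t..u}|lborel. alpha m) = alpha m * (u - t)"
        using u by (simp add: set_lebesgue_integral_def)
      ultimately have "(LINT r:{t..u}|lborel. alpha m - vol m t v r w) =
          alpha m * (u - t) - (LINT r:{t..u}|lborel. vol m t v r w)" by simp
      then show ?thesis
        unfolding set_integral_mult_right by (simp only:) (simp add: algebra_simps)
    qed
    have "\<mu> u = expectation (\<lambda>w. v + (theta m * alpha m * (u - t)
        - theta m * (LINT r:{t..u}|lborel. vol m t v r w)) + xi m * J w)"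
      unfolding \<mu>_def
    proof (rule integral_cong_AE)
      show "AE w in prb m. vol m t v u w = v + (theta m * alpha m * (u - t)
        - theta m * (LINT r:{t..u}|lborel. vol m t v r w)) + xi m * J w"
        using J AE_space by eventually_elim (simp only: drift)
      show "vol m t v u \<in> borel_measurable (prb m)" by (rule measurable_F[OF paths(1)[OF u]])
    qed (use I J0 in simp)
    also have "\<dots> = v + theta m * alpha m * (u - t) - theta m * (LINT r:{t..u}|lborel. \<mu> r)"
      using I J0 by (simp add: fub[OF u] prob_space)
    finally show ?thesis .
  qed
  have "running m (\<lambda>s v t. v) s v t = (LINT r:{t..horizon m}|lborel. \<mu> r)"
    unfolding running_def using fub[of "horizon m"] state by simp
  also have "\<dots> = (v - alpha m) / theta m * (1 - exp (- theta m * (horizon m - t))) + alpha m * (horizon m - t)"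
    by (rule linear_integral_equation[OF parameters(1) state(2) \<mu>_int eq])
  finally show ?thesis .
qed

end

end

section \<open>The linearised equation\<close>

text \<open>The values at six lattice points determine a quadratic polynomial in two
  variables.\<close>

lemma has_coeffs_unique:
  assumes "has_coeffs f a0 a1 a2 a11 a12 a22" "has_coeffs f b0 b1 b2 b11 b12 b22"
  shows "a1 = b1 \<and> a2 = b2 \<and> a11 = b11 \<and> a12 = b12 \<and> a22 = b22"
proof -
  have eq: "a0 + a1 * of_int x + a2 * of_int y + a11 * (of_int x)\<^sup>2 + a12 * of_int x * of_int y + a22 * (of_int y)\<^sup>2
      = b0 + b1 * of_int x + b2 * of_int y + b11 * (of_int x)\<^sup>2 + b12 * of_int x * of_int y + b22 * (of_int y)\<^sup>2"
    for x y :: int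
    using assms unfolding has_coeffs_def by metis
  show ?thesis
    using eq[of 0 0] eq[of 1 0] eq[of "-1" 0] eq[of 0 1] eq[of 0 "-1"] eq[of 1 1] by simp
qed

lemma sum_quotes: "(\<Sum>i\<in>quotes. f i) = f AskS + f BidS + f AskO + f BidO" for f :: "quote \<Rightarrow> real"
  by (simp add: quotes_def)

lemma risk_mult_variance:
  "risk m s v t x y * v = (of_int x)\<^sup>2 * v + 2 * of_int x * of_int y * cross_risk m s v t
     + (of_int y)\<^sup>2 * option_risk m s v t"
  by (simp add: risk_def cross_risk_def option_risk_def Let_def algebra_simps)

text \<open>For each asset the ask and bid premiums add up to \<open>2 / k\<close> minus a second
  difference of the ansatz, which is \<open>2 * c1\<close> or \<open>2 * c3\<close>, free of the
  inventories. Hence the sources of all nonconstant coefficients are explicit and the equations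
  decouple.\<close>

lemma linearised_source_coeffs:
  assumes "k \<noteq> 0"
  shows "has_coeffs (\<lambda>qs qo. linearised_source m A k (ansatz b1 b2 c1 c2 c3) s v qs qo t)
    (2 * A * (c1 s v t + c3 s v t)) 0 0
    (- gam m / 2 * v) (- gam m * cross_risk m s v t) (- gam m / 2 * option_risk m s v t)"
  unfolding has_coeffs_def
proof (intro allI)
  fix x y :: int
  have "(\<Sum>i\<in>quotes. premium k (ansatz b1 b2 c1 c2 c3) i s v x y t) = 4 / k - 2 * c1 s v t - 2 * c3 s v t"
    by (simp add: sum_quotes ansatz_def power2_eq_square algebra_simps)
  then have "linearised_source m A k (ansatz b1 b2 c1 c2 c3) s v x y t =
      - gam m / 2 * v * risk m s v t x y + A / k * (4 - k * (4 / k - 2 * c1 s v t - 2 * c3 s v t))"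
    by (simp only: linearised_source_def)
  also have "\<dots> = - gam m / 2 * (risk m s v t x y * v) + 2 * A * (c1 s v t + c3 s v t)"
    using assms by (simp add: field_simps)
  finally have "linearised_source m A k (ansatz b1 b2 c1 c2 c3) s v x y t =
      - gam m / 2 * (risk m s v t x y * v) + 2 * A * (c1 s v t + c3 s v t)" .
  then show "linearised_source m A k (ansatz b1 b2 c1 c2 c3) s v x y t =
      2 * A * (c1 s v t + c3 s v t) + 0 * of_int x + 0 * of_int y + - gam m / 2 * v * (of_int x)\<^sup>2
      + - gam m * cross_risk m s v t * of_int x * of_int y + - gam m / 2 * option_risk m s v t * (of_int y)\<^sup>2"
    unfolding risk_mult_variance by (simp add: algebra_simps)
qed

lemma running_cmult: "running m (\<lambda>s v t. c * f s v t) s v t = c * running m f s v t"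
  by (simp add: running_def)

section \<open>The coefficients of the ansatz\<close>

context heston_market
begin

context
  fixes t s v :: real
  assumes state: "0 \<le> t" "t \<le> horizon m" "0 \<le> v"
begin

text \<open>The state process visits only nonnegative variances and times up to the horizon, so
  agreement there suffices.\<close>

lemma running_cong:
  assumes "\<And>s v t. 0 \<le> v \<Longrightarrow> 0 \<le> t \<Longrightarrow> t \<le> horizon m \<Longrightarrow> f s v t = g s v t"
  shows "running m f s v t = running m g s v t"
  unfolding running_def
proof (intro Bochner_Integration.integral_cong refl set_lebesgue_integral_cong allI impI)
  fix w u assume "w \<in> space (prb m)" "u \<in> {t..horizon m}"
  then show "f (stock m t s v u w) (vol m t v u w) u = g (stock m t s v u w) (vol m t v u w) u"
    using paths(5)[OF state] state by (intro assms) auto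
qed simp

lemma running_integrable:
  assumes "finite_running m f"
  shows "integrable (prb m) (\<lambda>w. LINT u:{t..horizon m}|lborel. f (stock m t s v u w) (vol m t v u w) u)"
    and "AE w in prb m. set_integrable lborel {t..horizon m} (\<lambda>u. f (stock m t s v u w) (vol m t v u w) u)"
proof -
  have int: "integrable (prb m \<Otimes>\<^sub>M lborel)
          (\<lambda>(w, u). indicator {t..horizon m} u * f (stock m t s v u w) (vol m t v u w) u)"
    using assms state by (simp add: finite_running_def)
  show "integrable (prb m) (\<lambda>w. LINT u:{t..horizon m}|lborel. f (stock m t s v u w) (vol m t v u w) u)"
    using P.integrable_fst'[OF int] by (simp add: set_lebesgue_integral_def)
  show "AE w in prb m. set_integrable lborel {t..horizon m} (\<lambda>u. f (stock m t s v u w) (vol m t v u w) u)"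
    using P.AE_integrable_fst'[OF int] by (simp add: set_integrable_def)
qed

lemma stock_term_eq_running:
  assumes "finite_running m (\<lambda>s v t. v)"
  shows "- gam m / 2 * running m (\<lambda>s v t. v) s v t = - stock_term m v t"
  unfolding running_variance[OF state assms] stock_term_def using parameters(1) by (simp add: field_simps)

text \<open>The sources are given only existentially, but uniqueness of coefficients identifies them
  with those of \<open>linearised_source_coeffs\<close>; the Feynman-Kac formula then evaluates each
  one.\<close>

lemma approximate_coefficients:
  assumes fin: "finite_running m (\<lambda>s v t. v)" and k: "0 < k"
    and appr: "approximate_treatment m A k b1 b2 c1 c2 c3"
  shows "b1 s v t = 0" "b2 s v t = 0" "c1 s v t = - stock_term m v t" "c2 s v t = H1 m s v t" "c3 s v t = H2 m s v t"
proof -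
  obtain g0 g1 g2 g11 g12 g22 where
    g: "\<And>s v t. 0 \<le> v \<Longrightarrow> 0 \<le> t \<Longrightarrow> t \<le> horizon m \<Longrightarrow>
           has_coeffs (\<lambda>qs qo. linearised_source m A k (ansatz b1 b2 c1 c2 c3) s v qs qo t)
             (g0 s v t) (g1 s v t) (g2 s v t) (g11 s v t) (g12 s v t) (g22 s v t)"
    and fk: "feynman_kac m b1 g1" "feynman_kac m b2 g2"
        "feynman_kac m c1 g11" "feynman_kac m c2 g12" "feynman_kac m c3 g22"
    using appr unfolding approximate_treatment_def by blast
  have k0: "k \<noteq> 0" using k by simp
  have co: "g1 s v t = 0 \<and> g2 s v t = 0 \<and> g11 s v t = - gam m / 2 * v \<and>
      g12 s v t = - gam m * cross_risk m s v t \<and> g22 s v t = - gam m / 2 * option_risk m s v t"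
    if "0 \<le> v" "0 \<le> t" "t \<le> horizon m" for s v t
    by (rule has_coeffs_unique[OF g[OF that] linearised_source_coeffs[OF k0]])
  have f: "b1 s v t = running m g1 s v t" "b2 s v t = running m g2 s v t"
      "c1 s v t = running m g11 s v t" "c2 s v t = running m g12 s v t" "c3 s v t = running m g22 s v t"
    using fk state by (simp_all add: feynman_kac_def)
  \<comment> \<open>The zero sources are written as \<open>0 * v\<close> so that
    \<open>running_cmult\<close> evaluates all five expectations in the same way.\<close>
  have "running m g1 s v t = running m (\<lambda>s v t. 0 * v) s v t" "running m g2 s v t = running m (\<lambda>s v t. 0 * v) s v t"
    "running m g11 s v t = running m (\<lambda>s v t. - gam m / 2 * v) s v t"
    "running m g12 s v t = running m (\<lambda>s v t. - gam m * cross_risk m s v t) s v t"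
    "running m g22 s v t = running m (\<lambda>s v t. - gam m / 2 * option_risk m s v t) s v t"
    by (rule running_cong, simp add: co)+
  then show "b1 s v t = 0" "b2 s v t = 0" "c1 s v t = - stock_term m v t" "c2 s v t = H1 m s v t" "c3 s v t = H2 m s v t"
    unfolding f H1_def H2_def running_cmult stock_term_eq_running[OF fin, symmetric] by simp_all
qed

end

section \<open>Expected accumulated risk at frozen inventories\<close>

lemma finite_running_risk:
  assumes fin: "finite_running m (\<lambda>s v t. v)" "finite_running m (cross_risk m)" "finite_running m (option_risk m)"
  shows "finite_running m (\<lambda>s v t. risk m s v t x y * v)"
proof -
  have "(\<lambda>(w, u). indicator {t..horizon m} u * (risk m (stock m t s v u w) (vol m t v u w) u x y * vol m t v u w)) =
     (\<lambda>z. (of_int x)\<^sup>2 * (case z of (w, u) \<Rightarrow> indicator {t..horizon m} u * vol m t v u w)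
        + 2 * of_int x * of_int y * (case z of (w, u) \<Rightarrow> indicator {t..horizon m} u * cross_risk m (stock m t s v u w) (vol m t v u w) u)
        + (of_int y)\<^sup>2 * (case z of (w, u) \<Rightarrow> indicator {t..horizon m} u * option_risk m (stock m t s v u w) (vol m t v u w) u))"
    for s v t
    unfolding risk_mult_variance by (auto simp: algebra_simps)
  then show ?thesis
    using fin unfolding finite_running_def by simp
qed

context
  fixes t s v :: real
  assumes state: "0 \<le> t" "t \<le> horizon m" "0 \<le> v"
begin

lemma running_risk:
  assumes fin: "finite_running m (\<lambda>s v t. v)" "finite_running m (cross_risk m)" "finite_running m (option_risk m)"
  shows "running m (\<lambda>s v t. risk m s v t x y * v) s v t = (of_int x)\<^sup>2 * running m (\<lambda>s v t. v) s v t
    + 2 * of_int x * of_int y * running m (cross_risk m) s v t + (of_int y)\<^sup>2 * running m (option_risk m) s v t"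
proof -
  note int = running_integrable[OF state fin(1)] running_integrable[OF state fin(2), of s]
    running_integrable[OF state fin(3), of s]
  let ?I = "\<lambda>f w. LINT u:{t..horizon m}|lborel. f (stock m t s v u w) (vol m t v u w) u"
  have "running m (\<lambda>s v t. risk m s v t x y * v) s v t =
      expectation (\<lambda>w. (of_int x)\<^sup>2 * ?I (\<lambda>s v t. v) w + 2 * of_int x * of_int y * ?I (cross_risk m) w
        + (of_int y)\<^sup>2 * ?I (option_risk m) w)"
    unfolding running_def
  proof (rule integral_cong_AE)
    \<comment> \<open>Splitting the time integral requires the three weights to be integrable along
      the path, which holds almost surely.\<close>
    show "AE w in prb m. ?I (\<lambda>s v t. risk m s v t x y * v) w = (of_int x)\<^sup>2 * ?I (\<lambda>s v t. v) w
        + 2 * of_int x * of_int y * ?I (cross_risk m) w + (of_int y)\<^sup>2 * ?I (option_risk m) w"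
      using int(2,4,6)
    proof eventually_elim
      case (elim w)
      then show ?case unfolding risk_mult_variance by (simp add: set_integral_add)
    qed
    show "?I (\<lambda>s v t. risk m s v t x y * v) \<in> borel_measurable (prb m)"
      using running_integrable(1)[OF state finite_running_risk[OF fin]] by simp
  qed (use int(1,3,5) in simp)
  then show ?thesis
    using int(1,3,5) by (simp add: running_def)
qed

lemma approx_value_eq_running:
  assumes fin: "finite_running m (\<lambda>s v t. v)" "finite_running m (cross_risk m)" "finite_running m (option_risk m)"
  shows "approx_value m s v qs qo t = - gam m / 2 * running m (\<lambda>s v t. risk m s v t qs qo * v) s v t"
  unfolding running_risk[OF fin] approx_value_def stock_term_eq_running[OF state fin(1), symmetric, of s] H1_def H2_def
  by (simp add: algebra_simps)

text \<open>The inventories stay at their initial values and the premium integrals are integrals of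
  0, so only the running risk remains.\<close>

lemma inactive_value_eq_running:
  "inactive_value m s v qs qo t = - gam m / 2 * running m (\<lambda>s v t. risk m s v t qs qo * v) s v t"
  by (simp add: inactive_value_def objective_def payoff_def premium_path_def risk_path_def running_def
      inv_stock_def inv_option_def)

end

end

section \<open>Constant premiums\<close>

text \<open>The bound \<open>n\<^sup>2 \<le> 4 * 2 ^ n\<close> dominates the series by an
  exponential series in \<open>2 * r\<close>.\<close>

lemma integrable_square_poisson:
  assumes "0 < r"
  shows "integrable (measure_pmf (poisson_pmf r)) (\<lambda>n. (real n)\<^sup>2)"
proof -
  have "summable (\<lambda>n. 4 * exp (- r) * (inverse (fact n) * (2 * r) ^ n))"
    by (intro summable_mult summable_exp)
  then have "summable (\<lambda>n. norm (pmf (poisson_pmf r) n *\<^sub>R (real n)\<^sup>2))"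
  proof (rule summable_comparison_test'[of _ 0])
    fix n :: nat
    \<comment> \<open>The induction step doubles the bound and works from \<open>j = 3\<close> on;
      the factor 4 covers the small cases, as \<open>9 > 2 ^ 3\<close>.\<close>
    have "n\<^sup>2 \<le> 4 * 2 ^ n"
    proof (induction n rule: less_induct)
      case (less n)
      show ?case
      proof (cases "n \<le> 3")
        case True
        then have "n = 0 \<or> n = 1 \<or> n = 2 \<or> n = 3" by auto
        then show ?thesis by auto
      next
        case False
        then obtain j where j: "n = Suc j" "3 \<le> j" by (cases n) auto
        then have "3 * j \<le> j * j" by simp
        then have "Suc (j + j) \<le> j * j" using j(2) by linarith
        then have "(Suc j)\<^sup>2 \<le> 2 * j\<^sup>2" by (simp add: power2_eq_square)
        also have "\<dots> \<le> 4 * 2 ^ n" using less[of j] j by simp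
        finally show ?thesis using j by simp
      qed
    qed
    then have "real (n\<^sup>2) \<le> real (4 * 2 ^ n)" by (rule of_nat_mono)
    then have "r ^ n / fact n * exp (- r) * (real n)\<^sup>2 \<le> r ^ n / fact n * exp (- r) * (4 * 2 ^ n)"
      using assms by (intro mult_left_mono) auto
    also have "\<dots> = 4 * exp (- r) * (inverse (fact n) * (2 * r) ^ n)"
      by (simp add: power_mult_distrib divide_inverse mult_ac)
    finally show "norm (norm (pmf (poisson_pmf r) n *\<^sub>R (real n)\<^sup>2)) \<le> 4 * exp (- r) * (inverse (fact n) * (2 * r) ^ n)"
      using assms by simp
  qed
  then show ?thesis
    unfolding measure_pmf_eq_density by (simp add: integrable_density integrable_count_space_nat_iff)
qed

section \<open>Moments of the order clocks and their independence of the market\<close>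

context heston_market
begin

lemma clock_poisson: "unit_poisson_process (prb m) (clock m i)"
  using market by (simp add: market_model_def)

lemma
  assumes w: "w \<in> space (prb m)"
  shows clock_zero: "clock m i 0 w = 0"
    and clock_mono: "0 \<le> x \<Longrightarrow> x \<le> y \<Longrightarrow> clock m i x w \<le> clock m i y w"
    and clock_right_continuous: "0 \<le> x \<Longrightarrow> continuous (at_right x) (\<lambda>r. real (clock m i r w))"
proof -
  note p = clock_poisson[of i, unfolded unit_poisson_process_def]
  show "clock m i 0 w = 0" using p w by blast
  show "clock m i x w \<le> clock m i y w" if "0 \<le> x" "x \<le> y"
  proof -
    have "mono_on {0..} (\<lambda>u. clock m i u w)" using p w by blast
    with that show ?thesis by (auto simp: mono_on_def)
  qed
  show "continuous (at_right x) (\<lambda>r. real (clock m i r w))" if "0 \<le> x"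
  proof -
    have "continuous (at_right x) (\<lambda>r. clock m i r w)" using p w that by blast
    \<comment> \<open>The natural numbers are discrete, so right continuity means being constant
      just after \<open>x\<close>.\<close>
    then have "\<forall>\<^sub>F r in at_right x. clock m i r w = clock m i x w"
      by (simp add: continuous_within nhds_discrete filterlim_principal)
    then show ?thesis
      unfolding continuous_within by (intro tendsto_eventually) (auto elim: eventually_mono)
  qed
qed

lemma clock_measurable: "0 \<le> x \<Longrightarrow> clock m i x \<in> prb m \<rightarrow>\<^sub>M count_space UNIV"
  using clock_poisson[of i] by (simp add: unit_poisson_process_def)

lemma clock_measurable_real: "0 \<le> x \<Longrightarrow> (\<lambda>w. real (clock m i x w)) \<in> borel_measurable (prb m)"
  by (rule measurable_compose[OF clock_measurable]) auto

lemma clock_jointly_measurable: 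
  "(\<lambda>(w, x). real (clock m i (max 0 x) w)) \<in> borel_measurable (prb m \<Otimes>\<^sub>M borel)"
  by (rule borel_measurable_right_continuous_paths[where Y="\<lambda>x w. real (clock m i x w)"])
     (auto intro: clock_measurable_real clock_right_continuous)

lemma integrable_clock_square:
  assumes "0 < x"
  shows "integrable (prb m) (\<lambda>w. (real (clock m i x w))\<^sup>2)"
proof -
  \<comment> \<open>The Poisson law is given for increments; the clock is its own increment from
    time 0, where it vanishes, so the subtraction of natural numbers loses nothing.\<close>
  have meas: "(\<lambda>w. clock m i x w - clock m i 0 w) \<in> prb m \<rightarrow>\<^sub>M count_space UNIV"
    using clock_measurable[OF less_imp_le[OF assms], of i] clock_measurable[of 0 i] by measurable
  have "distr (prb m) (count_space UNIV) (\<lambda>w. clock m i x w - clock m i 0 w) = measure_pmf (poisson_pmf (x - 0))"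
    using clock_poisson[of i] assms unfolding unit_poisson_process_def by blast
  with integrable_square_poisson[OF assms]
  have "integrable (distr (prb m) (count_space UNIV) (\<lambda>w. clock m i x w - clock m i 0 w)) (\<lambda>n. (real n)\<^sup>2)"
    by simp
  then have "integrable (prb m) (\<lambda>w. (real (clock m i x w - clock m i 0 w))\<^sup>2)"
    by (subst (asm) integrable_distr_eq[OF meas]) auto
  then show ?thesis
    by (rule Bochner_Integration.integrable_cong[THEN iffD1, rotated 2]) (auto simp: clock_zero)
qed

lemma indep_clock_square:
  assumes f: "f \<in> borel_measurable (filt m (horizon m))" and x: "0 \<le> x"
  shows "indep_var borel f borel (\<lambda>w. (real (clock m i x w))\<^sup>2)"
proof -
  let ?G = "\<lambda>j. case j of None \<Rightarrow> sets (filt m (horizon m)) | Some i \<Rightarrow> history (prb m) (clock m i) {0..}"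
  have "indep_sets ?G UNIV"
    using market by (simp add: market_model_def)
  from indep_set_of_indep_sets[OF this, of None "Some i"]
  have "indep_set (sets (filt m (horizon m))) (history (prb m) (clock m i) {0..})" by simp
  then show ?thesis
  proof (rule indep_var_of_indep_set)
    show "f \<in> borel_measurable (prb m)" by (rule measurable_F[OF f])
    show "f -` A \<inter> space (prb m) \<in> sets (filt m (horizon m))" if "A \<in> sets borel" for A
      using measurable_sets[OF f that] by simp
    show "(\<lambda>w. (real (clock m i x w))\<^sup>2) \<in> borel_measurable (prb m)"
      using clock_measurable_real[OF x, of i] by measurable
    fix A :: "real set"
    have "(\<lambda>w. (real (clock m i x w))\<^sup>2) -` A \<inter> space (prb m) =
      clock m i x -` ((\<lambda>n. (real n)\<^sup>2) -` A) \<inter> space (prb m)" by auto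
    also have "\<dots> \<in> history (prb m) (clock m i) {0..}"
      unfolding history_def using x by (intro sigma_sets.Basic) auto
    finally show "(\<lambda>w. (real (clock m i x w))\<^sup>2) -` A \<inter> space (prb m) \<in> history (prb m) (clock m i) {0..}" .
  qed
qed

text \<open>Multiplied by the square of a common bound on the two inventories, this weight dominates
  the absolute running risk; see \<open>quadratic_form_le\<close>.\<close>

definition risk_bound :: field where
  "risk_bound s v t = v + 2 * \<bar>cross_risk m s v t\<bar> + \<bar>option_risk m s v t\<bar>"

text \<open>The derivatives of the call price are continuous only in the open interior of the state
  space, hence the indicator.\<close>

lemma risk_bound_measurable:
  "(\<lambda>x. indicator (UNIV \<times> {0<..} \<times> {0<..<horizon m}) x *\<^sub>R (case x of (s, v, t) \<Rightarrow> risk_bound s v t))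
    \<in> borel_measurable borel"
proof (rule borel_measurable_continuous_on_indicator)
  let ?S = "UNIV \<times> {0<..} \<times> {0<..<horizon m} :: (real \<times> real \<times> real) set"
  show "?S \<in> sets borel" by (intro borel_open open_Times) auto
  have "call_price m" using market by (simp add: market_model_def)
  then have C: "C122 (horizon m) (call m)" by (simp add: call_price_def Let_def)
  have c: "continuous_on ?S (\<lambda>(s, v, t). Ds (call m) s v t)" "continuous_on ?S (\<lambda>(s, v, t). Dv (call m) s v t)"
    using C unfolding C122_def by blast+
  show "continuous_on ?S (\<lambda>x. case x of (s, v, t) \<Rightarrow> risk_bound s v t)"
    unfolding risk_bound_def cross_risk_def option_risk_def
    using c unfolding split_beta' by (intro continuous_intros) auto
qed

lemma finite_running_risk_bound:
  assumes fin: "finite_running m (\<lambda>s v t. v)" "finite_running m (cross_risk m)" "finite_running m (option_risk m)"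
  shows "finite_running m risk_bound"
proof -
  have "(\<lambda>(w, u). indicator {t..horizon m} u * risk_bound (stock m t s v u w) (vol m t v u w) u) =
     (\<lambda>z. (case z of (w, u) \<Rightarrow> indicator {t..horizon m} u * vol m t v u w)
        + 2 * \<bar>case z of (w, u) \<Rightarrow> indicator {t..horizon m} u * cross_risk m (stock m t s v u w) (vol m t v u w) u\<bar>
        + \<bar>case z of (w, u) \<Rightarrow> indicator {t..horizon m} u * option_risk m (stock m t s v u w) (vol m t v u w) u\<bar>)"
    for s v t
    unfolding risk_bound_def by (auto simp: algebra_simps abs_mult)
  then show ?thesis
    using fin unfolding finite_running_def by simp
qed

text \<open>A product of independent integrable variables is integrable. Independence requires the
  market factor to be measurable relative to \<open>filt m (horizon m)\<close>, and the finiteness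
  assumptions give this only for \<open>prb m\<close>; a representative built from clipped paths
  closes the gap.\<close>

lemma integrable_clock_square_mult_risk_bound:
  assumes state: "0 \<le> t" "t \<le> horizon m" "0 \<le> v" and x: "0 < x"
    and fin: "finite_running m (\<lambda>s v t. v)" "finite_running m (cross_risk m)" "finite_running m (option_risk m)"
  shows "integrable (prb m) (\<lambda>w. (real (clock m i x w))\<^sup>2 *
    (LINT u:{t..horizon m}|lborel. risk_bound (stock m t s v u w) (vol m t v u w) u))"
proof -
  define h where "h x = indicator (UNIV \<times> {0<..} \<times> {0<..<horizon m}) x *\<^sub>R (case x of (s, v, t) \<Rightarrow> risk_bound s v t)"
    for x :: "real \<times> real \<times> real"
  let ?I = "\<lambda>w. LINT u:{t..horizon m}|lborel. risk_bound (stock m t s v u w) (vol m t v u w) u"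
  \<comment> \<open>Clipped paths and the cut-off weight \<open>h\<close> are measurable for the
    terminal sigma-algebra; \<open>f\<close> agrees with \<open>?I\<close> on the whole sample
    space.\<close>
  define f where "f w = (LINT u|lborel. indicator {t<..<horizon m} u *
      h (stock m t s v (clip t u) w, vol m t v (clip t u) w, u))" for w
  have [measurable]: "(\<lambda>(w, u). stock m t s v (clip t u) w) \<in> borel_measurable (filt m (horizon m) \<Otimes>\<^sub>M borel)"
    "(\<lambda>(w, u). vol m t v (clip t u) w) \<in> borel_measurable (filt m (horizon m) \<Otimes>\<^sub>M borel)"
    using stock_measurable[OF state] vol_measurable[OF state] .
  have "(\<lambda>z. (case z of (w, u) \<Rightarrow> stock m t s v (clip t u) w, case z of (w, u) \<Rightarrow> vol m t v (clip t u) w, snd z))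
      \<in> filt m (horizon m) \<Otimes>\<^sub>M borel \<rightarrow>\<^sub>M borel \<Otimes>\<^sub>M (borel \<Otimes>\<^sub>M (borel :: real measure))"
    by (intro measurable_Pair) measurable
  from measurable_compose[OF this[unfolded borel_prod] risk_bound_measurable[folded h_def]]
  have hm[measurable]: "(\<lambda>(w, u). h (stock m t s v (clip t u) w, vol m t v (clip t u) w, u)) \<in> borel_measurable (filt m (horizon m) \<Otimes>\<^sub>M borel)"
    by (simp add: split_beta')
  have fm: "f \<in> borel_measurable (filt m (horizon m))"
    unfolding f_def by (intro lborel.borel_measurable_lebesgue_integral) measurable
  have eq: "f w = ?I w" if w: "w \<in> space (prb m)" for w
    unfolding f_def set_lebesgue_integral_def
  proof (rule integral_cong_AE)
    have "AE u in lborel. u \<noteq> t" "AE u in lborel. u \<noteq> horizon m" by (rule AE_lborel_singleton)+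
    then show "AE u in lborel. indicator {t<..<horizon m} u * h (stock m t s v (clip t u) w, vol m t v (clip t u) w, u) =
        indicator {t..horizon m} u *\<^sub>R risk_bound (stock m t s v u w) (vol m t v u w) u"
    proof eventually_elim
      case (elim u)
      show ?case
      proof (cases "u \<in> {t<..<horizon m}")
        case True
        then have u: "u \<in> {t..horizon m}" "clip t u = u" "0 < u" "u < horizon m" using state by auto
        \<comment> \<open>All three weights carry the variance as a factor, so they vanish where it
          is 0 and the cut to positive variance changes nothing.\<close>
        have "h (stock m t s v u w, vol m t v u w, u) = risk_bound (stock m t s v u w) (vol m t v u w) u"
          using u(3,4) paths(5)[OF state w u(1)]
          by (cases "vol m t v u w = 0") (simp_all add: h_def risk_bound_def cross_risk_def option_risk_def)
        then show ?thesis
          using u(1) True unfolding u(2) by simp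
      qed (use elim in \<open>auto simp: indicator_def\<close>)
    qed
    have w': "w \<in> space (filt m (horizon m))" using w by simp
    have "(\<lambda>u. h (stock m t s v (clip t u) w, vol m t v (clip t u) w, u)) \<in> borel_measurable lborel"
      using measurable_Pair2[OF hm w'] by simp
    then show "(\<lambda>u. indicator {t<..<horizon m} u * h (stock m t s v (clip t u) w, vol m t v (clip t u) w, u)) \<in> borel_measurable lborel"
      by (intro borel_measurable_times) auto
    have "(\<lambda>(w, u). indicator {t..horizon m} u * risk_bound (stock m t s v u w) (vol m t v u w) u) \<in> borel_measurable (prb m \<Otimes>\<^sub>M lborel)"
      by (rule borel_measurable_integrable)
         (use finite_running_risk_bound[OF fin] state in \<open>simp add: finite_running_def\<close>)
    from measurable_Pair2[OF this w]
    show "(\<lambda>u. indicator {t..horizon m} u *\<^sub>R risk_bound (stock m t s v u w) (vol m t v u w) u) \<in> borel_measurable lborel"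
      by simp
  qed
  have "integrable (prb m) ?I"
    by (rule running_integrable[OF state finite_running_risk_bound[OF fin]])
  then have fi: "integrable (prb m) f"
    by (rule Bochner_Integration.integrable_cong[THEN iffD2, rotated 2]) (auto simp: eq)
  have "0 \<le> x" using x by simp
  from indep_var_integrable[OF indep_clock_square[OF fm this] fi integrable_clock_square[OF x]]
  show ?thesis
    by (rule Bochner_Integration.integrable_cong[THEN iffD1, rotated 2]) (auto simp: eq mult.commute)
qed

end

lemma square_sum_five_le: "(a + b + c + d + e)\<^sup>2 \<le> 5 * (a\<^sup>2 + b\<^sup>2 + c\<^sup>2 + d\<^sup>2 + (e :: real)\<^sup>2)"
proof -
  have "0 \<le> (a - b)\<^sup>2 + (a - c)\<^sup>2 + (a - d)\<^sup>2 + (a - e)\<^sup>2 + (b - c)\<^sup>2 + (b - d)\<^sup>2 + (b - e)\<^sup>2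
      + (c - d)\<^sup>2 + (c - e)\<^sup>2 + (d - e)\<^sup>2" by (intro add_nonneg_nonneg zero_le_power2)
  then show ?thesis by (simp add: power2_eq_square algebra_simps)
qed

lemma quadratic_form_le:
  fixes x y a b c \<kappa> :: real
  assumes "\<bar>x\<bar> \<le> \<kappa>" "\<bar>y\<bar> \<le> \<kappa>" "0 \<le> a"
  shows "\<bar>x\<^sup>2 * a + 2 * x * y * b + y\<^sup>2 * c\<bar> \<le> \<kappa>\<^sup>2 * (a + 2 * \<bar>b\<bar> + \<bar>c\<bar>)"
proof -
  have sq: "x\<^sup>2 \<le> \<kappa>\<^sup>2" "y\<^sup>2 \<le> \<kappa>\<^sup>2" using assms by (simp_all add: abs_le_square_iff[symmetric])
  have "\<bar>x\<bar> * \<bar>y\<bar> \<le> \<kappa> * \<kappa>" using assms by (intro mult_mono) auto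
  then have xy: "\<bar>x * y\<bar> \<le> \<kappa>\<^sup>2" by (simp add: abs_mult power2_eq_square)
  have "\<bar>x\<^sup>2 * a + 2 * x * y * b + y\<^sup>2 * c\<bar> \<le> \<bar>x\<^sup>2 * a\<bar> + \<bar>2 * x * y * b\<bar> + \<bar>y\<^sup>2 * c\<bar>" by simp
  also have "\<dots> = x\<^sup>2 * a + 2 * (\<bar>x * y\<bar> * \<bar>b\<bar>) + y\<^sup>2 * \<bar>c\<bar>"
    using assms(3) by (simp add: abs_mult)
  also have "\<dots> \<le> \<kappa>\<^sup>2 * a + 2 * (\<kappa>\<^sup>2 * \<bar>b\<bar>) + \<kappa>\<^sup>2 * \<bar>c\<bar>"
    using sq xy assms(3) by (intro add_mono mult_left_mono mult_right_mono) auto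
  finally show ?thesis by (simp add: algebra_simps)
qed

section \<open>The order flow generated by a constant premium\<close>

context heston_market
begin

text \<open>A constant premium gives a constant intensity \<open>r\<close>, so the accumulated
  intensity is linear in time and there is no feedback through the inventories. The maximum keeps
  the clock at 0 before \<open>t\<close>, the minimum stops it at the horizon.\<close>

definition constant_rate_flow :: "real \<Rightarrow> real \<Rightarrow> 'w flow" where
  "constant_rate_flow r t i u w = clock m i (max 0 (r * (min u (horizon m) - t))) w"

lemma constant_rate_flow_jointly_measurable:
  "(\<lambda>(w, u). real (constant_rate_flow r t i u w)) \<in> borel_measurable (prb m \<Otimes>\<^sub>M borel)"
proof -
  have "(\<lambda>z. (fst z, r * (min (snd z) (horizon m) - t))) \<in> prb m \<Otimes>\<^sub>M borel \<rightarrow>\<^sub>M prb m \<Otimes>\<^sub>M (borel :: real measure)"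
    by (intro measurable_Pair) measurable
  from measurable_compose[OF this clock_jointly_measurable[of i]] show ?thesis
    by (simp add: constant_rate_flow_def split_beta')
qed

lemma constant_rate_flow_right_continuous:
  assumes w: "w \<in> space (prb m)" and r: "0 \<le> r"
  shows "continuous (at_right u) (\<lambda>u. real (constant_rate_flow r t i u w))"
proof -
  let ?h = "\<lambda>u. max 0 (r * (min u (horizon m) - t))"
  have "continuous (at (?h u) within {?h u..}) (\<lambda>x. real (clock m i x w))"
    using clock_right_continuous[OF w, of "?h u" i]
    unfolding continuous_within at_within_Ici_at_right by simp
  \<comment> \<open>The time change is nondecreasing, so it maps right neighbourhoods into the side
    on which the clock is continuous.\<close>
  moreover have "?h ` {u<..} \<subseteq> {?h u..}"
    using r by (auto intro!: max.mono mult_left_mono)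
  ultimately have "continuous (at (?h u) within ?h ` {u<..}) (\<lambda>x. real (clock m i x w))"
    by (rule continuous_within_subset)
  then show ?thesis
    unfolding constant_rate_flow_def
    by (rule continuous_within_compose2[where f="?h" and g="\<lambda>x. real (clock m i x w)", rotated])
       (intro continuous_intros)
qed

lemma constant_rate_flow_mono:
  assumes "w \<in> space (prb m)" "0 \<le> r" "u \<le> u'"
  shows "constant_rate_flow r t i u w \<le> constant_rate_flow r t i u' w"
  unfolding constant_rate_flow_def
proof (rule clock_mono[OF assms(1)])
  have "r * (min u (horizon m) - t) \<le> r * (min u' (horizon m) - t)"
    using assms by (intro mult_left_mono) auto
  then show "max 0 (r * (min u (horizon m) - t)) \<le> max 0 (r * (min u' (horizon m) - t))"
    by simp
qed simp

text \<open>The bound holds uniformly over all rates up to \<open>a\<close>, so one clock value can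
  serve in dominated convergence.\<close>

lemma constant_rate_flow_le:
  assumes "w \<in> space (prb m)" "0 \<le> r" "r \<le> a" "0 \<le> t" "0 < a"
  shows "constant_rate_flow r t i u w \<le> clock m i (a * horizon m) w"
  unfolding constant_rate_flow_def
proof (rule clock_mono)
  have "r * (min u (horizon m) - t) \<le> r * horizon m"
    using assms by (intro mult_left_mono) auto
  also have "\<dots> \<le> a * horizon m" using assms parameters(2) by (intro mult_right_mono) auto
  finally show "max 0 (r * (min u (horizon m) - t)) \<le> a * horizon m"
    using assms parameters(2) by simp
qed (use assms in auto)

lemma constant_rate_flow_initial:
  assumes "w \<in> space (prb m)" "t \<le> horizon m"
  shows "constant_rate_flow r t i t w = 0"
  using clock_zero[OF assms(1)] assms(2) by (simp add: constant_rate_flow_def)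

text \<open>The Stieltjes measure of the half-open interval is the number of arrivals, since the
  flow starts at 0.\<close>

lemma constant_premium_collected:
  assumes w: "w \<in> space (prb m)" and r: "0 \<le> r" and t: "t \<le> horizon m"
  shows "(LINT u:{t<..horizon m}|interval_measure (\<lambda>u. real (constant_rate_flow r t i u w)). \<delta>)
    = \<delta> * real (constant_rate_flow r t i (horizon m) w)"
proof -
  let ?F = "\<lambda>u. real (constant_rate_flow r t i u w)"
  have "emeasure (interval_measure ?F) {t<..horizon m} = ?F (horizon m) - ?F t"
    using t w r by (intro emeasure_interval_measure_Ioc constant_rate_flow_right_continuous)
      (auto intro: constant_rate_flow_mono)
  then have "measure (interval_measure ?F) {t<..horizon m} = ?F (horizon m)"
    and "emeasure (interval_measure ?F) {t<..horizon m} < \<infinity>"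
    by (simp_all add: measure_def constant_rate_flow_initial[OF w t])
  then show ?thesis
    by (simp add: set_lebesgue_integral_def)
qed

lemma constant_rate_flow_order_flow:
  assumes r: "0 \<le> r" and int: "\<And>i. intensity m i \<delta> = r"
  shows "order_flow m s v qs qo t (\<lambda>_ _ _ _ _ _. \<delta>) (constant_rate_flow r t)"
  unfolding order_flow_def premium_path_def int
proof (intro conjI allI AE_I2)
  show "constant_rate_flow r t i u \<in> prb m \<rightarrow>\<^sub>M count_space UNIV" for i u
    unfolding constant_rate_flow_def[abs_def] by (rule clock_measurable) simp
  show "set_integrable lborel {t..horizon m} (\<lambda>_. r)"
    by (intro borel_integrable_atLeastAtMost' continuous_intros)
  show "constant_rate_flow r t i u w = clock m i (LINT _:{t..min u (horizon m)}|lborel. r) w" for i u w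
  proof (cases "t \<le> min u (horizon m)")
    case True
    then have "0 \<le> r * (min u (horizon m) - t)" using r by (intro mult_nonneg_nonneg) auto
    then show ?thesis using True by (simp add: constant_rate_flow_def set_lebesgue_integral_def mult.commute)
  next
    \<comment> \<open>The interval of integration is empty, and both clocks are read at 0.\<close>
    case False
    then have "r * (min u (horizon m) - t) \<le> 0" using r by (intro mult_nonneg_nonpos) auto
    then show ?thesis using False by (simp add: constant_rate_flow_def set_lebesgue_integral_def)
  qed
qed

section \<open>Accumulated risk as the order rates tend to zero\<close>

context
  fixes t s v :: real and qs qo :: int and a :: real
  assumes state: "0 \<le> t" "t \<le> horizon m" "0 \<le> v" and a: "0 < a"
    and fin: "finite_running m (\<lambda>s v t. v)" "finite_running m (cross_risk m)" "finite_running m (option_risk m)"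
begin

text \<open>By \<open>square_sum_five_le\<close> this dominates the squared inventories at every
  rate up to \<open>a\<close>. The sum of squares form lets each clock be separated from the market
  by independence.\<close>

definition activity :: "'w \<Rightarrow> real" where
  "activity w = 5 * ((\<bar>of_int qs\<bar> + \<bar>of_int qo\<bar>)\<^sup>2 + (\<Sum>i\<in>quotes. (real (clock m i (a * horizon m) w))\<^sup>2))"

lemma risk_path_le:
  assumes w: "w \<in> space (prb m)" and u: "u \<in> {t..horizon m}" and r: "0 \<le> r" "r \<le> a"
  shows "\<bar>risk_path m s v qs qo t (constant_rate_flow r t) u w\<bar> \<le>
    activity w * risk_bound (stock m t s v u w) (vol m t v u w) u"
proof -
  let ?N = "\<lambda>i. constant_rate_flow r t i u w" and ?C = "\<lambda>i. real (clock m i (a * horizon m) w)"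
  \<comment> \<open>Both inventories are bounded by the initial positions plus the number of all
    arrivals.\<close>
  define \<kappa> where "\<kappa> = (\<bar>of_int qs\<bar> + \<bar>of_int qo\<bar>) + ?C AskS + ?C BidS + ?C AskO + ?C BidO"
  have N: "real (?N i) \<le> ?C i" for i
    using constant_rate_flow_le[OF w r state(1) a] by simp
  have x: "\<bar>real_of_int (inv_stock qs (constant_rate_flow r t) u w)\<bar> \<le> \<kappa>"
    "\<bar>real_of_int (inv_option qo (constant_rate_flow r t) u w)\<bar> \<le> \<kappa>"
    using N[of AskS] N[of BidS] N[of AskO] N[of BidO]
    unfolding \<kappa>_def inv_stock_def inv_option_def by simp_all
  have v: "0 \<le> vol m t v u w" by (rule paths(5)[OF state w u])
  have "\<bar>risk_path m s v qs qo t (constant_rate_flow r t) u w\<bar> \<le>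
      \<kappa>\<^sup>2 * risk_bound (stock m t s v u w) (vol m t v u w) u"
    unfolding risk_path_def risk_mult_variance risk_bound_def by (rule quadratic_form_le[OF x v])
  also have "\<dots> \<le> activity w * risk_bound (stock m t s v u w) (vol m t v u w) u"
    unfolding \<kappa>_def activity_def sum_quotes
    by (intro mult_right_mono order_trans[OF square_sum_five_le]) (use v in \<open>auto simp: risk_bound_def\<close>)
  finally show ?thesis .
qed

lemma activity_integrable:
  "integrable (prb m) (\<lambda>w. activity w *
    (LINT u:{t..horizon m}|lborel. risk_bound (stock m t s v u w) (vol m t v u w) u))"
proof -
  have aT: "0 < a * horizon m" using a parameters(2) by simp
  show ?thesis
    unfolding activity_def sum_quotes
    using integrable_clock_square_mult_risk_bound[OF state aT fin, of _ s]
      running_integrable(1)[OF state finite_running_risk_bound[OF fin], of s]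
    by (simp add: distrib_left distrib_right mult.assoc)
qed

lemma risk_path_jointly_measurable:
  "(\<lambda>(w, u). indicator {t..horizon m} u * risk_path m s v qs qo t (constant_rate_flow r t) u w)
    \<in> borel_measurable (prb m \<Otimes>\<^sub>M lborel)"
proof -
  note [measurable] = constant_rate_flow_jointly_measurable
  have f: "(\<lambda>(w, u). indicator {t..horizon m} u * f (stock m t s v u w) (vol m t v u w) u)
      \<in> borel_measurable (prb m \<Otimes>\<^sub>M lborel)" if "finite_running m f" for f
    using that state unfolding finite_running_def by (intro borel_measurable_integrable) simp
  have [measurable]: "(\<lambda>(w, u). real_of_int (inv_stock qs (constant_rate_flow r t) u w)) \<in> borel_measurable (prb m \<Otimes>\<^sub>M lborel)"
    "(\<lambda>(w, u). real_of_int (inv_option qo (constant_rate_flow r t) u w)) \<in> borel_measurable (prb m \<Otimes>\<^sub>M lborel)"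
    unfolding inv_stock_def inv_option_def by (simp_all add: split_beta') measurable
  note [measurable] = f[OF fin(1)] f[OF fin(2)] f[OF fin(3)]
  \<comment> \<open>The risk is expanded so that the indicator falls on the three weights, whose
    joint measurability comes from their finite expectations.\<close>
  have "(\<lambda>(w, u). indicator {t..horizon m} u * risk_path m s v qs qo t (constant_rate_flow r t) u w) =
    (\<lambda>z. (case z of (w, u) \<Rightarrow> real_of_int (inv_stock qs (constant_rate_flow r t) u w))\<^sup>2
          * (case z of (w, u) \<Rightarrow> indicator {t..horizon m} u * vol m t v u w)
        + 2 * (case z of (w, u) \<Rightarrow> real_of_int (inv_stock qs (constant_rate_flow r t) u w))
          * (case z of (w, u) \<Rightarrow> real_of_int (inv_option qo (constant_rate_flow r t) u w))
          * (case z of (w, u) \<Rightarrow> indicator {t..horizon m} u * cross_risk m (stock m t s v u w) (vol m t v u w) u)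
        + (case z of (w, u) \<Rightarrow> real_of_int (inv_option qo (constant_rate_flow r t) u w))\<^sup>2
          * (case z of (w, u) \<Rightarrow> indicator {t..horizon m} u * option_risk m (stock m t s v u w) (vol m t v u w) u))"
    unfolding risk_path_def risk_mult_variance by (auto simp: algebra_simps)
  also have "\<dots> \<in> borel_measurable (prb m \<Otimes>\<^sub>M lborel)"
    by measurable
  finally show ?thesis .
qed

lemma accumulated_risk_measurable:
  "(\<lambda>w. LINT u:{t..horizon m}|lborel. risk_path m s v qs qo t (constant_rate_flow r t) u w) \<in> borel_measurable (prb m)"
  unfolding set_lebesgue_integral_def real_scaleR_def
  by (intro lborel.borel_measurable_lebesgue_integral risk_path_jointly_measurable)

lemma accumulated_risk_le:
  assumes r: "0 \<le> r" "r \<le> a"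
  shows "AE w in prb m. set_integrable lborel {t..horizon m} (\<lambda>u. risk_path m s v qs qo t (constant_rate_flow r t) u w)"
    and "AE w in prb m. norm (LINT u:{t..horizon m}|lborel. risk_path m s v qs qo t (constant_rate_flow r t) u w)
      \<le> activity w * (LINT u:{t..horizon m}|lborel. risk_bound (stock m t s v u w) (vol m t v u w) u)"
proof -
  have "AE w in prb m.
      set_integrable lborel {t..horizon m} (\<lambda>u. risk_path m s v qs qo t (constant_rate_flow r t) u w) \<and>
      norm (LINT u:{t..horizon m}|lborel. risk_path m s v qs qo t (constant_rate_flow r t) u w)
      \<le> activity w * (LINT u:{t..horizon m}|lborel. risk_bound (stock m t s v u w) (vol m t v u w) u)"
    using running_integrable(2)[OF state finite_running_risk_bound[OF fin], of s] AE_space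
  proof eventually_elim
    case (elim w)
    let ?p = "\<lambda>u. risk_path m s v qs qo t (constant_rate_flow r t) u w"
    let ?b = "\<lambda>u. activity w * risk_bound (stock m t s v u w) (vol m t v u w) u"
    have b: "set_integrable lborel {t..horizon m} ?b"
      using elim(1) by (rule set_integrable_mult_right)
    have le: "\<bar>?p u\<bar> \<le> ?b u" if "u \<in> {t..horizon m}" for u
      by (rule risk_path_le[OF elim(2) that r])
    have p: "set_integrable lborel {t..horizon m} ?p"
      unfolding set_integrable_def
    proof (rule Bochner_Integration.integrable_bound[OF b[unfolded set_integrable_def]])
      show "(\<lambda>u. indicator {t..horizon m} u *\<^sub>R ?p u) \<in> borel_measurable lborel"
        using measurable_Pair2[OF risk_path_jointly_measurable elim(2)] by simp
      show "AE u in lborel. norm (indicator {t..horizon m} u *\<^sub>R ?p u) \<le> norm (indicator {t..horizon m} u *\<^sub>R ?b u)"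
        using le by (intro AE_I2) (auto simp: indicator_def intro: order_trans[OF _ abs_ge_self])
    qed
    have "norm (LINT u:{t..horizon m}|lborel. ?p u) \<le> (LINT u:{t..horizon m}|lborel. ?b u)"
      unfolding set_lebesgue_integral_def
      using b[unfolded set_integrable_def]
      by (rule Bochner_Integration.integral_norm_bound_integral[OF p[unfolded set_integrable_def]])
         (use le in \<open>auto simp: indicator_def\<close>)
    then show ?case
      using p unfolding set_integral_mult_right by simp
  qed
  then show "AE w in prb m. set_integrable lborel {t..horizon m} (\<lambda>u. risk_path m s v qs qo t (constant_rate_flow r t) u w)"
    and "AE w in prb m. norm (LINT u:{t..horizon m}|lborel. risk_path m s v qs qo t (constant_rate_flow r t) u w)
      \<le> activity w * (LINT u:{t..horizon m}|lborel. risk_bound (stock m t s v u w) (vol m t v u w) u)"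
    by (auto elim: eventually_mono)
qed

lemma accumulated_risk_integrable:
  assumes r: "0 \<le> r" "r \<le> a"
  shows "integrable (prb m) (\<lambda>w. LINT u:{t..horizon m}|lborel. risk_path m s v qs qo t (constant_rate_flow r t) u w)"
proof (rule Bochner_Integration.integrable_bound[OF activity_integrable accumulated_risk_measurable])
  show "AE w in prb m. norm (LINT u:{t..horizon m}|lborel. risk_path m s v qs qo t (constant_rate_flow r t) u w)
      \<le> norm (activity w * (LINT u:{t..horizon m}|lborel. risk_bound (stock m t s v u w) (vol m t v u w) u))"
    using accumulated_risk_le(2)[OF r] by eventually_elim simp
qed

lemma order_flow_terminal_integrable:
  assumes r: "0 \<le> r" "r \<le> a"
  shows "integrable (prb m) (\<lambda>w. real (constant_rate_flow r t i (horizon m) w))"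
proof (rule Bochner_Integration.integrable_bound)
  have aT: "0 < a * horizon m" using a parameters(2) by simp
  show "integrable (prb m) (\<lambda>w. (real (clock m i (a * horizon m) w))\<^sup>2)"
    by (rule integrable_clock_square[OF aT])
  show "(\<lambda>w. real (constant_rate_flow r t i (horizon m) w)) \<in> borel_measurable (prb m)"
    unfolding constant_rate_flow_def by (rule clock_measurable_real) simp
  \<comment> \<open>For counting variables the square dominates the variable itself.\<close>
  have sq: "n \<le> j\<^sup>2" if "n \<le> j" for n j :: nat
    using that by (cases j) (auto simp: power2_eq_square)
  show "AE w in prb m. norm (real (constant_rate_flow r t i (horizon m) w)) \<le> norm ((real (clock m i (a * horizon m) w))\<^sup>2)"
    using sq[OF constant_rate_flow_le[OF _ r state(1) a]] by (intro AE_I2) simp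
qed

lemma payoff_constant_premium:
  assumes w: "w \<in> space (prb m)" and r: "0 \<le> r"
  shows "payoff m s v qs qo t (\<lambda>_ _ _ _ _ _. \<delta>) (constant_rate_flow r t) w =
    \<delta> * (\<Sum>i\<in>quotes. real (constant_rate_flow r t i (horizon m) w))
    - gam m / 2 * (LINT u:{t..horizon m}|lborel. risk_path m s v qs qo t (constant_rate_flow r t) u w)"
proof -
  have "(LINT u:{t<..horizon m}|interval_measure (\<lambda>u. real (constant_rate_flow r t i u w)).
      premium_path m s v qs qo t (\<lambda>_ _ _ _ _ _. \<delta>) (constant_rate_flow r t) i u w) =
      \<delta> * real (constant_rate_flow r t i (horizon m) w)" for i
    unfolding premium_path_def by (rule constant_premium_collected[OF w r state(2)])
  then show ?thesis
    unfolding payoff_def sum_distrib_left by (simp only:)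
qed

text \<open>With a nonnegative premium the expected premium income is nonnegative, so discarding it
  leaves a lower bound for the objective.\<close>

lemma constant_premium_objective:
  assumes int: "\<And>i. intensity m i \<delta> = r" and r: "0 \<le> r" "r \<le> a" and \<delta>: "0 \<le> \<delta>"
  shows "admissible m s v qs qo t (\<lambda>_ _ _ _ _ _. \<delta>) (constant_rate_flow r t)"
    and "- gam m / 2 * expectation (\<lambda>w. LINT u:{t..horizon m}|lborel. risk_path m s v qs qo t (constant_rate_flow r t) u w)
      \<le> objective m s v qs qo t (\<lambda>_ _ _ _ _ _. \<delta>) (constant_rate_flow r t)"
proof -
  let ?Z = "\<lambda>w. LINT u:{t..horizon m}|lborel. risk_path m s v qs qo t (constant_rate_flow r t) u w"
  let ?R = "\<lambda>w. \<Sum>i\<in>quotes. real (constant_rate_flow r t i (horizon m) w)"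
  have Z: "integrable (prb m) ?Z" by (rule accumulated_risk_integrable[OF r])
  have R: "integrable (prb m) ?R" by (intro Bochner_Integration.integrable_sum order_flow_terminal_integrable r)
  have eq: "payoff m s v qs qo t (\<lambda>_ _ _ _ _ _. \<delta>) (constant_rate_flow r t) w = \<delta> * ?R w - gam m / 2 * ?Z w"
    if "w \<in> space (prb m)" for w
    by (rule payoff_constant_premium[OF that r(1)])
  have pI: "integrable (prb m) (\<lambda>w. \<delta> * ?R w - gam m / 2 * ?Z w)"
    using Z R by simp
  have "integrable (prb m) (payoff m s v qs qo t (\<lambda>_ _ _ _ _ _. \<delta>) (constant_rate_flow r t))"
    using pI by (rule Bochner_Integration.integrable_cong[THEN iffD2, rotated 2]) (auto simp only: eq)
  then show "admissible m s v qs qo t (\<lambda>_ _ _ _ _ _. \<delta>) (constant_rate_flow r t)"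
    unfolding admissible_def
    using constant_rate_flow_order_flow[OF r(1) int] accumulated_risk_le(1)[OF r] by auto
  have "0 \<le> expectation ?R" by (intro Bochner_Integration.integral_nonneg sum_nonneg) simp
  then have "- gam m / 2 * expectation ?Z \<le> \<delta> * expectation ?R - gam m / 2 * expectation ?Z"
    using \<delta> by simp
  also have "\<dots> = expectation (\<lambda>w. \<delta> * ?R w - gam m / 2 * ?Z w)"
    using Z R by (simp only: Bochner_Integration.integral_diff integrable_mult_right integral_mult_right_zero)
  also have "\<dots> = objective m s v qs qo t (\<lambda>_ _ _ _ _ _. \<delta>) (constant_rate_flow r t)"
    unfolding objective_def by (intro Bochner_Integration.integral_cong) (auto simp only: eq)
  finally show "- gam m / 2 * expectation ?Z \<le> objective m s v qs qo t (\<lambda>_ _ _ _ _ _. \<delta>) (constant_rate_flow r t)" .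
qed

text \<open>On each path the flow at the horizon is an integer that tends to 0, so for large
  \<open>n\<close> there are no arrivals and the accumulated risk equals that at frozen inventories.
  The dominating variable is \<open>activity\<close> times the accumulated
  \<open>risk_bound\<close>.\<close>

lemma accumulated_risk_tendsto:
  assumes r: "\<And>n. 0 \<le> r n" "\<And>n. r n \<le> a" and lim: "r \<longlonglongrightarrow> 0"
  shows "(\<lambda>n. expectation (\<lambda>w. LINT u:{t..horizon m}|lborel. risk_path m s v qs qo t (constant_rate_flow (r n) t) u w))
    \<longlonglongrightarrow> running m (\<lambda>s v t. risk m s v t qs qo * v) s v t"
  unfolding running_def
proof (rule integral_dominated_convergence)
  show "integrable (prb m) (\<lambda>w. activity w *
    (LINT u:{t..horizon m}|lborel. risk_bound (stock m t s v u w) (vol m t v u w) u))" by (rule activity_integrable)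
  show "(\<lambda>w. LINT u:{t..horizon m}|lborel. risk_path m s v qs qo t (constant_rate_flow (r n) t) u w) \<in> borel_measurable (prb m)" for n
    by (rule accumulated_risk_measurable)
  show "AE w in prb m. norm (LINT u:{t..horizon m}|lborel. risk_path m s v qs qo t (constant_rate_flow (r n) t) u w)
      \<le> activity w * (LINT u:{t..horizon m}|lborel. risk_bound (stock m t s v u w) (vol m t v u w) u)" for n
    by (rule accumulated_risk_le(2)[OF r])
  show "(\<lambda>w. LINT u:{t..horizon m}|lborel. risk m (stock m t s v u w) (vol m t v u w) u qs qo * vol m t v u w)
      \<in> borel_measurable (prb m)"
    using running_integrable(1)[OF state finite_running_risk[OF fin], of s qs qo] by simp
  show "AE w in prb m. (\<lambda>n. LINT u:{t..horizon m}|lborel. risk_path m s v qs qo t (constant_rate_flow (r n) t) u w)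
      \<longlonglongrightarrow> (LINT u:{t..horizon m}|lborel. risk m (stock m t s v u w) (vol m t v u w) u qs qo * vol m t v u w)"
  proof (rule AE_I2, rule tendsto_eventually)
    fix w assume w: "w \<in> space (prb m)"
    have "\<forall>\<^sub>F n in sequentially. constant_rate_flow (r n) t i (horizon m) w = 0" for i
    proof -
      have "(\<lambda>n. real (clock m i (max 0 (r n * (horizon m - t))) w)) \<longlonglongrightarrow> real (clock m i 0 w)"
      proof (rule tendsto_right_continuous[OF clock_right_continuous[OF w]])
        have "(\<lambda>n. max 0 (r n * (horizon m - t))) \<longlonglongrightarrow> max 0 (0 * (horizon m - t))"
          by (intro tendsto_intros lim)
        then show "(\<lambda>n. max 0 (r n * (horizon m - t))) \<longlonglongrightarrow> 0" by simp
      qed auto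
      then have "(\<lambda>n. real (constant_rate_flow (r n) t i (horizon m) w)) \<longlonglongrightarrow> 0"
        by (simp add: constant_rate_flow_def clock_zero[OF w])
      then have "\<forall>\<^sub>F n in sequentially. real (constant_rate_flow (r n) t i (horizon m) w) < 1"
        by (rule order_tendstoD) simp
      then show ?thesis by (rule eventually_mono) simp
    qed
    from this[of AskS] this[of BidS] this[of AskO] this[of BidO]
    show "\<forall>\<^sub>F n in sequentially.
        (LINT u:{t..horizon m}|lborel. risk_path m s v qs qo t (constant_rate_flow (r n) t) u w) =
        (LINT u:{t..horizon m}|lborel. risk m (stock m t s v u w) (vol m t v u w) u qs qo * vol m t v u w)"
    proof eventually_elim
      case (elim n)
      have "constant_rate_flow (r n) t i u w = 0" if "u \<in> {t..horizon m}" for i u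
      proof -
        have "constant_rate_flow (r n) t i u w \<le> constant_rate_flow (r n) t i (horizon m) w"
          using that by (intro constant_rate_flow_mono w r) auto
        with elim show ?thesis by (cases i) auto
      qed
      then show ?case
        unfolding risk_path_def inv_stock_def inv_option_def
        by (intro set_lebesgue_integral_cong) auto
    qed
  qed
qed

text \<open>The constant premium \<open>n\<close> produces the rate
  \<open>a * exp (- k * n)\<close>, which tends to 0; each such policy is admissible and bounds
  \<open>V\<close> from below, and the limit of these bounds is the inactive value.\<close>

lemma running_risk_le_value:
  assumes V: "is_value_function m V" and k: "0 < k"
    and int: "\<And>i \<delta>. intensity m i \<delta> = a * exp (- k * \<delta>)"
  shows "- gam m / 2 * running m (\<lambda>s v t. risk m s v t qs qo * v) s v t \<le> V s v qs qo t"
proof -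
  define r where "r n = a * exp (- k * real n)" for n
  have r: "0 \<le> r n" "r n \<le> a" for n
    using a k by (simp_all add: r_def)
  have "filterlim (\<lambda>n. - k * real n) at_bot sequentially"
    using k by (intro filterlim_tendsto_neg_mult_at_bot[OF tendsto_const _ filterlim_real_sequentially]) simp
  then have "(\<lambda>n. a * exp (- k * real n)) \<longlonglongrightarrow> a * 0"
    by (intro tendsto_intros filterlim_compose[OF exp_at_bot])
  then have lim: "r \<longlonglongrightarrow> 0" by (simp add: r_def[abs_def])
  have "(\<lambda>n. - gam m / 2 * expectation (\<lambda>w. LINT u:{t..horizon m}|lborel. risk_path m s v qs qo t (constant_rate_flow (r n) t) u w))
    \<longlonglongrightarrow> - gam m / 2 * running m (\<lambda>s v t. risk m s v t qs qo * v) s v t"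
    by (intro tendsto_mult tendsto_const accumulated_risk_tendsto r lim)
  moreover have "- gam m / 2 * expectation (\<lambda>w. LINT u:{t..horizon m}|lborel. risk_path m s v qs qo t (constant_rate_flow (r n) t) u w)
      \<le> V s v qs qo t" for n
  proof -
    have i: "intensity m i (real n) = r n" for i by (simp add: int r_def)
    note c = constant_premium_objective[OF i r of_nat_0_le_iff]
    have "objective m s v qs qo t (\<lambda>_ _ _ _ _ _. real n) (constant_rate_flow (r n) t) \<le> V s v qs qo t"
      using V state c(1) unfolding is_value_function_def by simp
    with c(2) show ?thesis by simp
  qed
  ultimately show ?thesis
    by (intro LIMSEQ_le_const2) auto
qed

end

end

section \<open>The approximate policy, its value and the lower bound\<close>

theorem theorem4p5:
  fixes m :: "'w model"
    and A k :: real
    and V :: "real \<Rightarrow> real \<Rightarrow> int \<Rightarrow> int \<Rightarrow> real \<Rightarrow> real"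
  assumes model: "market_model m"
    and Ak: "A > 0" "k > 0"
    and intensities: "\<And>i \<delta>. intensity m i \<delta> = A * exp (- k * \<delta>)"
    and finite_stock: "finite_running m (\<lambda>s v t. v)"
    and finite_cross: "finite_running m (cross_risk m)"
    and finite_option: "finite_running m (option_risk m)"
    and value_V: "is_value_function m V"
    and smooth_V: "\<And>qs qo. C122 (horizon m) (\<lambda>s v t. V s v qs qo t)"
  shows "(\<forall>b1 b2 c1 c2 c3. approximate_treatment m A k b1 b2 c1 c2 c3 \<longrightarrow>
            (\<forall>s v qs qo t. 0 \<le> v \<and> 0 \<le> t \<and> t \<le> horizon m \<longrightarrow>
               premium k (ansatz b1 b2 c1 c2 c3) AskS s v qs qo t =
                 1 / k - stock_term m v t * (2 * of_int qs - 1) + H1 m s v t * of_int qo \<and>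
               premium k (ansatz b1 b2 c1 c2 c3) BidS s v qs qo t =
                 1 / k + stock_term m v t * (2 * of_int qs + 1) - H1 m s v t * of_int qo \<and>
               premium k (ansatz b1 b2 c1 c2 c3) AskO s v qs qo t =
                 1 / k + H2 m s v t * (2 * of_int qo - 1) + H1 m s v t * of_int qs \<and>
               premium k (ansatz b1 b2 c1 c2 c3) BidO s v qs qo t =
                 1 / k - H2 m s v t * (2 * of_int qo + 1) - H1 m s v t * of_int qs \<and>
               ansatz b1 b2 c1 c2 c3 s v qs qo t = approx_value m s v qs qo t))
         \<and> (\<forall>s v qs qo t. 0 \<le> v \<and> 0 \<le> t \<and> t \<le> horizon m \<longrightarrow>
               approx_value m s v qs qo t = inactive_value m s v qs qo t \<and>
               approx_value m s v qs qo t \<le> V s v qs qo t)"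
proof -
  interpret heston_market m by (rule heston_market.intro[OF model])
  note fin = finite_stock finite_cross finite_option
  have treat: "premium k (ansatz b1 b2 c1 c2 c3) AskS s v qs qo t =
          1 / k - stock_term m v t * (2 * of_int qs - 1) + H1 m s v t * of_int qo \<and>
        premium k (ansatz b1 b2 c1 c2 c3) BidS s v qs qo t =
          1 / k + stock_term m v t * (2 * of_int qs + 1) - H1 m s v t * of_int qo \<and>
        premium k (ansatz b1 b2 c1 c2 c3) AskO s v qs qo t =
          1 / k + H2 m s v t * (2 * of_int qo - 1) + H1 m s v t * of_int qs \<and>
        premium k (ansatz b1 b2 c1 c2 c3) BidO s v qs qo t =
          1 / k - H2 m s v t * (2 * of_int qo + 1) - H1 m s v t * of_int qs \<and>
        ansatz b1 b2 c1 c2 c3 s v qs qo t = approx_value m s v qs qo t"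
    if "approximate_treatment m A k b1 b2 c1 c2 c3" "0 \<le> v" "0 \<le> t" "t \<le> horizon m"
    for b1 b2 c1 c2 c3 s v qs qo t
    using approximate_coefficients[OF that(3,4,2) finite_stock Ak(2) that(1)]
    by (simp add: ansatz_def approx_value_def power2_eq_square algebra_simps)
  \<comment> \<open>Both the approximate and the inactive value equal minus \<open>gam m / 2\<close>
    times the expected accumulated risk at frozen inventories.\<close>
  have val: "approx_value m s v qs qo t = inactive_value m s v qs qo t \<and> approx_value m s v qs qo t \<le> V s v qs qo t"
    if "0 \<le> v" "0 \<le> t" "t \<le> horizon m" for s v qs qo t
    unfolding approx_value_eq_running[OF that(2,3,1) fin] inactive_value_eq_running[OF that(2,3,1)]
    using running_risk_le_value[OF that(2,3,1) Ak(1) fin value_V Ak(2) intensities] by simp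
  show ?thesis
    by (rule conjI; intro allI impI treat val; simp)
qed

end
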